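(* Let $G$ be a finite group. Then $\mathcal{V}_n(\mathbb{Z}G)=\{1\}$ for some $n\geq 1$ if and only if either (i) $G$ is an abelian cut-group; or (ii) $G\cong K_8\times E$, where $K_8$ denotes the quaternion group of order $8$ and $E$ denotes an elementary abelian $2$-group.
   Context: For a group $G$, $\mathbb{Z}G$ is the integral group ring, $\Delta(G)$ is its augmentation ideal (the kernel of the augmentation map $\mathbb{Z}G\to\mathbb{Z}$, $\sum n_g g\mapsto \sum n_g$), and $\Delta^n(G)$ is the $n$-th power of this ideal. $\mathcal{V}(\mathbb{Z}G)$ is the group of units of augmentation one in $\mathbb{Z}G$, and for $n\ge 1$, $\mathcal{V}_n(\mathbb{Z}G)=\mathcal{V}(\mathbb{Z}G)\cap(1+\Delta^n(G))$. A group $G$ is called a cut-group if all central units of $\mathbb{Z}G$ are trivial, i.e. of the form $\pm g$ with $g\in G$; an abelian group is a cut-group if and only if its exponent divides $4$ or $6$. The trivial group is regarded as an elementary abelian $2$-group. *)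

theory Defs
  imports "HOL-Algebra.Algebra"
begin

section \<open>Integral group rings\<close>

text \<open>
  Additively, the group ring is \<^const>\<open>free_Abelian_group\<close> on the carrier of the group; the
  multiplication is the bilinear extension of the group multiplication. A group element \<open>g\<close>
  is embedded as \<^term>\<open>frag_of g\<close>.
\<close>

definition group_ring :: "('a, 'b) monoid_scheme \<Rightarrow> ('a \<Rightarrow>\<^sub>0 int) ring" where
  "group_ring G =
    \<lparr>carrier = {a. Poly_Mapping.keys a \<subseteq> carrier G},
     monoid.mult = (\<lambda>a b. frag_extend (\<lambda>x. frag_extend (\<lambda>y. frag_of (x \<otimes>\<^bsub>G\<^esub> y)) b) a),
     one = frag_of \<one>\<^bsub>G\<^esub>,
     ring.zero = 0,
     ring.add = (+)\<rparr>"

definition augmentation :: "('a \<Rightarrow>\<^sub>0 int) \<Rightarrow> int" where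
  "augmentation a = (\<Sum>x\<in>Poly_Mapping.keys a. Poly_Mapping.lookup a x)"

definition augmentation_ideal :: "('a, 'b) monoid_scheme \<Rightarrow> ('a \<Rightarrow>\<^sub>0 int) set" where
  "augmentation_ideal G = a_kernel (group_ring G) \<Z> augmentation"

definition augmentation_ideal_power :: "('a, 'b) monoid_scheme \<Rightarrow> nat \<Rightarrow> ('a \<Rightarrow>\<^sub>0 int) set" where
  "augmentation_ideal_power G n = augmentation_ideal G [^]\<^bsub>ideals_set (group_ring G)\<^esub> n"

definition normalized_units :: "('a, 'b) monoid_scheme \<Rightarrow> ('a \<Rightarrow>\<^sub>0 int) set" where
  "normalized_units G = {u \<in> Units (group_ring G). augmentation u = 1}"

definition congruence_units :: "('a, 'b) monoid_scheme \<Rightarrow> nat \<Rightarrow> ('a \<Rightarrow>\<^sub>0 int) set" where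
  "congruence_units G n =
    normalized_units G \<inter> (\<one>\<^bsub>group_ring G\<^esub> <+\<^bsub>group_ring G\<^esub> augmentation_ideal_power G n)"

definition central_units :: "('a, 'b) monoid_scheme \<Rightarrow> ('a \<Rightarrow>\<^sub>0 int) set" where
  "central_units G =
    {u \<in> Units (group_ring G).
      \<forall>a \<in> carrier (group_ring G). u \<otimes>\<^bsub>group_ring G\<^esub> a = a \<otimes>\<^bsub>group_ring G\<^esub> u}"

definition cut_group :: "('a, 'b) monoid_scheme \<Rightarrow> bool" where
  "cut_group G \<longleftrightarrow> group G \<and> (\<forall>u \<in> central_units G. \<exists>g \<in> carrier G. u = frag_of g \<or> u = - frag_of g)"


section \<open>The quaternion group and elementary abelian 2-groups\<close>

text \<open>The tuple \<open>(a, b, c, d)\<close> stands for the quaternion \<open>a + b i + c j + d k\<close>.\<close>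

type_synonym int_quat = "int \<times> int \<times> int \<times> int"

fun quat_mult :: "int_quat \<Rightarrow> int_quat \<Rightarrow> int_quat" where
  "quat_mult (a, b, c, d) (a', b', c', d') =
    (a * a' - b * b' - c * c' - d * d',
     a * b' + b * a' + c * d' - d * c',
     a * c' - b * d' + c * a' + d * b',
     a * d' + b * c' - c * b' + d * a')"

definition K8 :: "int_quat monoid" where
  "K8 =
    \<lparr>carrier = {(1, 0, 0, 0), (-1, 0, 0, 0), (0, 1, 0, 0), (0, -1, 0, 0),
                (0, 0, 1, 0), (0, 0, -1, 0), (0, 0, 0, 1), (0, 0, 0, -1)},
     monoid.mult = quat_mult,
     one = (1, 0, 0, 0)\<rparr>"

text \<open>The trivial group is included.\<close>

definition elementary_abelian_2_group :: "('a, 'b) monoid_scheme \<Rightarrow> bool" where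
  "elementary_abelian_2_group E \<longleftrightarrow> comm_group E \<and> (\<forall>x \<in> carrier E. x \<otimes>\<^bsub>E\<^esub> x = \<one>\<^bsub>E\<^esub>)"


section \<open>Basic facts\<close>

lemma group_ring_simps:
  "carrier (group_ring G) = {a. Poly_Mapping.keys a \<subseteq> carrier G}"
  "a \<otimes>\<^bsub>group_ring G\<^esub> b = frag_extend (\<lambda>x. frag_extend (\<lambda>y. frag_of (x \<otimes>\<^bsub>G\<^esub> y)) b) a"
  "\<one>\<^bsub>group_ring G\<^esub> = frag_of \<one>\<^bsub>G\<^esub>"
  "\<zero>\<^bsub>group_ring G\<^esub> = 0"
  "a \<oplus>\<^bsub>group_ring G\<^esub> b = a + b"
  by (simp_all add: group_ring_def)

lemma group_ring_mult_frag_of [simp]: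
  "frag_of x \<otimes>\<^bsub>group_ring G\<^esub> frag_of y = frag_of (x \<otimes>\<^bsub>G\<^esub> y)"
  by (simp add: group_ring_simps)

lemma frag_extend_fun_add:
  "frag_extend (\<lambda>x. f x + g x) a = frag_extend f a + frag_extend g a"
  by (simp add: frag_extend_def frag_cmul_distrib2 sum.distrib)

lemma frag_extend_fun_diff:
  "frag_extend (\<lambda>x. f x - g x) a = frag_extend f a - frag_extend g a"
  using frag_extend_fun_add[of "\<lambda>x. f x - g x" g a] by (simp add: algebra_simps)

lemma group_ring_mult_diff:
  "(a - b) \<otimes>\<^bsub>group_ring G\<^esub> c = a \<otimes>\<^bsub>group_ring G\<^esub> c - b \<otimes>\<^bsub>group_ring G\<^esub> c"
  "a \<otimes>\<^bsub>group_ring G\<^esub> (b - c) = a \<otimes>\<^bsub>group_ring G\<^esub> b - a \<otimes>\<^bsub>group_ring G\<^esub> c"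
  by (simp_all add: group_ring_simps frag_extend_diff frag_extend_fun_diff)

lemma group_ring_mult_add:
  "(a + b) \<otimes>\<^bsub>group_ring G\<^esub> c = a \<otimes>\<^bsub>group_ring G\<^esub> c + b \<otimes>\<^bsub>group_ring G\<^esub> c"
  "a \<otimes>\<^bsub>group_ring G\<^esub> (b + c) = a \<otimes>\<^bsub>group_ring G\<^esub> b + a \<otimes>\<^bsub>group_ring G\<^esub> c"
  by (simp_all add: group_ring_simps frag_extend_add frag_extend_fun_add)

lemma group_ring_mult_zero [simp]:
  "0 \<otimes>\<^bsub>group_ring G\<^esub> c = 0" "c \<otimes>\<^bsub>group_ring G\<^esub> 0 = 0"
  using group_ring_mult_diff(1)[of G 0 0 c] group_ring_mult_diff(2)[of G c 0 0] by simp_all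

lemma group_ring_mult_closed:
  assumes "monoid G" "Poly_Mapping.keys a \<subseteq> carrier G" "Poly_Mapping.keys b \<subseteq> carrier G"
  shows "Poly_Mapping.keys (a \<otimes>\<^bsub>group_ring G\<^esub> b) \<subseteq> carrier G"
proof -
  interpret monoid G by fact
  have "Poly_Mapping.keys (frag_extend (\<lambda>y. frag_of (x \<otimes>\<^bsub>G\<^esub> y)) b) \<subseteq> carrier G"
    if "x \<in> carrier G" for x
    using assms(3) that
    by (intro order_trans[OF keys_frag_extend]) auto
  then show ?thesis
    unfolding group_ring_simps using assms(2)
    by (intro order_trans[OF keys_frag_extend]) blast
qed

lemma group_ring_mult_assoc:
  assumes "monoid G"
    and a: "Poly_Mapping.keys a \<subseteq> carrier G"
    and b: "Poly_Mapping.keys b \<subseteq> carrier G"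
    and c: "Poly_Mapping.keys c \<subseteq> carrier G"
  shows "a \<otimes>\<^bsub>group_ring G\<^esub> b \<otimes>\<^bsub>group_ring G\<^esub> c = a \<otimes>\<^bsub>group_ring G\<^esub> (b \<otimes>\<^bsub>group_ring G\<^esub> c)"
  using a
proof (induction a rule: frag_induction)
  case (one x)
  note x = one
  show ?case
    using b
  proof (induction b rule: frag_induction)
    case (one y)
    note y = one
    show ?case
      using c
    proof (induction c rule: frag_induction)
      case (one z)
      then show ?case
        using x y monoid.m_assoc[OF \<open>monoid G\<close>] by simp
    qed (auto simp: group_ring_mult_diff)
  qed (auto simp: group_ring_mult_diff)
qed (auto simp: group_ring_mult_diff)

lemma group_ring_one:
  assumes "monoid G" "Poly_Mapping.keys a \<subseteq> carrier G"
  shows "frag_of \<one>\<^bsub>G\<^esub> \<otimes>\<^bsub>group_ring G\<^esub> a = a" "a \<otimes>\<^bsub>group_ring G\<^esub> frag_of \<one>\<^bsub>G\<^esub> = a"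
proof -
  interpret monoid G by fact
  show "frag_of \<one>\<^bsub>G\<^esub> \<otimes>\<^bsub>group_ring G\<^esub> a = a"
    using assms(2) by (induction a rule: frag_induction) (auto simp: group_ring_mult_diff)
  show "a \<otimes>\<^bsub>group_ring G\<^esub> frag_of \<one>\<^bsub>G\<^esub> = a"
    using assms(2) by (induction a rule: frag_induction) (auto simp: group_ring_mult_diff)
qed

lemma ring_group_ring:
  assumes "monoid G"
  shows "ring (group_ring G)"
proof (rule ringI)
  show "abelian_group (group_ring G)"
  proof (rule abelian_groupI)
    fix x assume "x \<in> carrier (group_ring G)"
    then show "\<exists>y\<in>carrier (group_ring G). y \<oplus>\<^bsub>group_ring G\<^esub> x = \<zero>\<^bsub>group_ring G\<^esub>"
      by (intro bexI[of _ "- x"]) (auto simp: group_ring_simps)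
  qed (auto simp: group_ring_simps add_ac dest: subsetD[OF keys_add])
  show "monoid (group_ring G)"
  proof (rule monoidI)
    show "\<one>\<^bsub>group_ring G\<^esub> \<in> carrier (group_ring G)"
      using monoid.one_closed[OF assms] by (simp add: group_ring_simps)
  next
    fix a b assume "a \<in> carrier (group_ring G)" "b \<in> carrier (group_ring G)"
    then show "a \<otimes>\<^bsub>group_ring G\<^esub> b \<in> carrier (group_ring G)"
      using group_ring_mult_closed[OF assms] by (simp add: group_ring_simps(1))
  next
    fix a b c
    assume "a \<in> carrier (group_ring G)" "b \<in> carrier (group_ring G)" "c \<in> carrier (group_ring G)"
    then show "a \<otimes>\<^bsub>group_ring G\<^esub> b \<otimes>\<^bsub>group_ring G\<^esub> c = a \<otimes>\<^bsub>group_ring G\<^esub> (b \<otimes>\<^bsub>group_ring G\<^esub> c)"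
      using group_ring_mult_assoc[OF assms] by (simp add: group_ring_simps(1))
  qed (simp_all add: group_ring_simps(1,3) group_ring_one[OF assms])
qed (simp_all add: group_ring_simps(5) group_ring_mult_add)

lemma augmentation_eq_sum:
  assumes "finite A" "Poly_Mapping.keys a \<subseteq> A"
  shows "augmentation a = (\<Sum>x\<in>A. Poly_Mapping.lookup a x)"
  unfolding augmentation_def using assms
  by (intro sum.mono_neutral_left) (auto simp: in_keys_iff)

lemma augmentation_frag_of [simp]: "augmentation (frag_of x) = 1"
  by (simp add: augmentation_def)

lemma augmentation_zero [simp]: "augmentation 0 = 0"
  by (simp add: augmentation_def)

lemma augmentation_add: "augmentation (a + b) = augmentation a + augmentation b"
  using augmentation_eq_sum[of "Poly_Mapping.keys a \<union> Poly_Mapping.keys b"]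
  by (simp add: keys_add lookup_add sum.distrib)

lemma augmentation_diff: "augmentation (a - b) = augmentation a - augmentation b"
  using augmentation_add[of "a - b" b] by simp

lemma augmentation_mult:
  "augmentation (a \<otimes>\<^bsub>group_ring G\<^esub> b) = augmentation a * augmentation b"
  using subset_UNIV[of "Poly_Mapping.keys a"]
proof (induction a rule: frag_induction)
  case (one x)
  show ?case
    using subset_UNIV[of "Poly_Mapping.keys b"]
    by (induction b rule: frag_induction)
       (auto simp: group_ring_mult_diff augmentation_diff right_diff_distrib)
qed (auto simp: group_ring_mult_diff augmentation_diff left_diff_distrib)

lemma augmentation_ring_hom:
  assumes "monoid G"
  shows "ring_hom_ring (group_ring G) \<Z> augmentation"
  by (rule ring_hom_ringI2[OF ring_group_ring[OF assms] cring.axioms(1)[OF int_is_cring]])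
     (auto simp: ring_hom_def augmentation_mult group_ring_simps(3,5) augmentation_add)

lemma ideal_augmentation_ideal:
  assumes "monoid G"
  shows "ideal (augmentation_ideal G) (group_ring G)"
  unfolding augmentation_ideal_def
  by (rule ring_hom_ring.kernel_is_ideal[OF augmentation_ring_hom[OF assms]])

lemma augmentation_ideal_power_0: "augmentation_ideal_power G 0 = carrier (group_ring G)"
  by (simp add: augmentation_ideal_power_def ideals_set_def)

lemma augmentation_ideal_power_Suc:
  "augmentation_ideal_power G (Suc n) =
     augmentation_ideal_power G n \<cdot>\<^bsub>group_ring G\<^esub> augmentation_ideal G"
  by (simp add: augmentation_ideal_power_def ideals_set_def nat_pow_def)

lemma quat_mult_assoc: "quat_mult (quat_mult p q) r = quat_mult p (quat_mult q r)"
  by (cases p; cases q; cases r) (simp add: algebra_simps)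

lemma group_K8: "group K8"
proof (rule groupI)
  have "\<forall>x \<in> carrier K8. \<forall>y \<in> carrier K8. quat_mult x y \<in> carrier K8"
    by (simp add: K8_def)
  moreover have mult: "x \<otimes>\<^bsub>K8\<^esub> y = quat_mult x y" for x y
    by (simp add: K8_def)
  ultimately show "x \<otimes>\<^bsub>K8\<^esub> y \<in> carrier K8" if "x \<in> carrier K8" "y \<in> carrier K8" for x y
    using that by simp
  have "\<forall>x \<in> carrier K8. \<exists>y \<in> carrier K8. quat_mult y x = \<one>\<^bsub>K8\<^esub>"
    by (simp add: K8_def)
  then show "\<exists>y\<in>carrier K8. y \<otimes>\<^bsub>K8\<^esub> x = \<one>\<^bsub>K8\<^esub>" if "x \<in> carrier K8" for x
    using that by (simp add: mult)
  show "x \<otimes>\<^bsub>K8\<^esub> y \<otimes>\<^bsub>K8\<^esub> z = x \<otimes>\<^bsub>K8\<^esub> (y \<otimes>\<^bsub>K8\<^esub> z)" for x y z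
    by (simp add: mult quat_mult_assoc)
  show "\<one>\<^bsub>K8\<^esub> \<in> carrier K8"
    by (simp add: K8_def)
  show "\<one>\<^bsub>K8\<^esub> \<otimes>\<^bsub>K8\<^esub> x = x" for x
    by (cases x) (simp add: K8_def)
qed

lemma order_K8: "order K8 = 8"
  by (simp add: order_def K8_def)

text \<open>
  In a decomposition of \<open>G\<close> as a product of \<^const>\<open>K8\<close> and \<open>E\<close>, the type of the elements
  of \<open>E\<close> may be taken to be that of the elements of \<open>G\<close>.
\<close>

lemma elementary_abelian_2_factor_type:
  fixes G :: "('a, 'm) monoid_scheme" and E' :: "('b, 'n) monoid_scheme"
  assumes "group G" "elementary_abelian_2_group E'" "G \<cong> K8 \<times>\<times> E'"
  shows "\<exists>E :: 'a monoid. elementary_abelian_2_group E \<and> G \<cong> K8 \<times>\<times> E"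
proof -
  interpret G: group G by fact
  interpret E': comm_group E'
    using assms(2) by (simp add: elementary_abelian_2_group_def)
  interpret K8: group K8 by (rule group_K8)
  obtain f where f: "f \<in> iso (K8 \<times>\<times> E') G"
    using G.iso_sym[OF assms(3)] by (auto simp: is_iso_def)
  define i where "i = (\<lambda>e. f (\<one>\<^bsub>K8\<^esub>, e))"
  define E :: "'a monoid" where "E = \<lparr>carrier = i ` carrier E', monoid.mult = monoid.mult G, one = i \<one>\<^bsub>E'\<^esub>\<rparr>"
  have mult: "i x \<otimes>\<^bsub>G\<^esub> i y = i (x \<otimes>\<^bsub>E'\<^esub> y)" if "x \<in> carrier E'" "y \<in> carrier E'" for x y
  proof -
    have "f ((\<one>\<^bsub>K8\<^esub>, x) \<otimes>\<^bsub>K8 \<times>\<times> E'\<^esub> (\<one>\<^bsub>K8\<^esub>, y)) = f (\<one>\<^bsub>K8\<^esub>, x) \<otimes>\<^bsub>G\<^esub> f (\<one>\<^bsub>K8\<^esub>, y)"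
      using f that by (intro hom_mult) (auto simp: iso_def)
    then show ?thesis by (simp add: i_def)
  qed
  have inj: "inj_on i (carrier E')"
    using f by (auto simp: i_def iso_def bij_betw_def inj_on_def)
  have "comm_group E"
  proof (rule comm_groupI)
    fix x assume "x \<in> carrier E"
    then obtain x' where x': "x' \<in> carrier E'" "x = i x'" by (auto simp: E_def)
    then show "\<exists>y\<in>carrier E. y \<otimes>\<^bsub>E\<^esub> x = \<one>\<^bsub>E\<^esub>"
      by (intro bexI[of _ "i (inv\<^bsub>E'\<^esub> x')"]) (auto simp: E_def mult)
  qed (auto simp: E_def mult E'.m_ac)
  moreover have "\<forall>x \<in> carrier E. x \<otimes>\<^bsub>E\<^esub> x = \<one>\<^bsub>E\<^esub>"
    using assms(2) by (auto simp: E_def mult elementary_abelian_2_group_def)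
  moreover have "i \<in> iso E' E"
    using inj by (auto simp: iso_def hom_def bij_betw_def E_def mult)
  then have "K8 \<times>\<times> E' \<cong> K8 \<times>\<times> E"
    by (intro K8.DirProd_iso_trans) (auto simp: is_iso_def intro: iso_set_refl)
  ultimately show ?thesis
    using assms(3) iso_trans unfolding elementary_abelian_2_group_def by blast
qed

end

theory Submission
  imports Defs
    "HOL-Library.Product_Plus"
    "HOL-Computational_Algebra.Polynomial"
    "HOL-Number_Theory.Residues"
begin

text \<open>
  Let \<open>\<Delta>\<close> be the augmentation ideal, \<open>V\<close> the group of units of augmentation one and \<open>V\<^sub>n\<close> its subgroup of
  units congruent to one modulo \<open>\<Delta>^n\<close>.

  Suppose that \<open>V\<^sub>n\<close> is trivial. As \<open>|G|\<close> annihilates \<open>\<Delta>^j / \<Delta>^(j+1)\<close> for \<open>j \<ge> 1\<close>, raising to the power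
  \<open>|G|\<close> maps \<open>V\<^sub>j\<close> into \<open>V\<^sub>j\<^sub>+\<^sub>1\<close>; so all units in \<open>V\<close> have finite order
  (\<open>torsion_of_congruence_units_trivial\<close>). This is tested on two explicit families of units. A bicyclic
  unit \<open>1 + (a - 1) b S\<close>, where \<open>S\<close> is the sum over a subgroup containing \<open>a\<close>, is unipotent, so it has to
  be \<open>1\<close>, which makes all cyclic subgroups of \<open>G\<close> normal (\<open>conjugate_power_of_units_torsion\<close>). A Bass
  cyclic unit of an element of order \<open>n\<close> must have absolute value one at the primitive \<open>n\<close>-th roots of
  unity, which leaves only the orders \<open>1, 2, 3, 4, 6\<close> (\<open>coprime_bound_of_units_torsion\<close>). If \<open>G\<close> is
  commutative, positivity of the trace form shows that units of finite order are trivial, so \<open>G\<close> is a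
  cut-group (\<open>torsion_unit_trivial\<close>). If \<open>G\<close> is not commutative, normality of cyclic subgroups and the
  short list of orders lead to two generators of a quaternion group, whose cosets are all represented
  by central elements of square one (\<open>quaternion_decomposition\<close>); splitting off the quaternion group
  gives the product decomposition (\<open>iso_K8_times_elementary_abelian\<close>).

  Conversely, in both cases all units are trivial, so \<open>V = G\<close>. For commutative cut-groups this is the
  definition. For \<open>K8 \<times> E\<close>, the unit group of the integral group ring of \<open>K8\<close> is found by Parseval's
  identity (\<open>K8_unit_sum_squares\<close>), and adjoining central involutions does not create nontrivial units
  (\<open>trivial_units_on_extend\<close>). It remains to find \<open>n\<close> such that \<open>g - 1 \<in> \<Delta>^n\<close> implies \<open>g = 1\<close>. For
  commutative groups \<open>n = 2\<close> works, because the identity map of \<open>G\<close> extends to an additive map from the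
  group ring to \<open>G\<close> that is trivial on \<open>\<Delta>\<^sup>2\<close> (\<open>hom_trivial_of_augmentation_ideal_square\<close>). For \<open>K8 \<times> E\<close>
  one takes \<open>n = 5\<close>: the component in \<open>E\<close> is treated in the same way, and the quaternion representation
  maps \<open>\<Delta>^5\<close> into the multiples of four (\<open>quat_eval_augmentation_ideal_power\<close>).
\<close>

section \<open>Arithmetic in group rings\<close>

lemma frag_cmul_mult:
  "frag_cmul c a \<otimes>\<^bsub>group_ring G\<^esub> b = frag_cmul c (a \<otimes>\<^bsub>group_ring G\<^esub> b)"
  "a \<otimes>\<^bsub>group_ring G\<^esub> frag_cmul c b = frag_cmul c (a \<otimes>\<^bsub>group_ring G\<^esub> b)"
proof -
  have *: "frag_extend (\<lambda>x. frag_cmul c (f x)) a = frag_cmul c (frag_extend f a)"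
    for f :: "'a \<Rightarrow> 'a \<Rightarrow>\<^sub>0 int"
    by (simp add: frag_extend_def frag_cmul_sum mult.commute)
  show "frag_cmul c a \<otimes>\<^bsub>group_ring G\<^esub> b = frag_cmul c (a \<otimes>\<^bsub>group_ring G\<^esub> b)"
    by (simp add: group_ring_simps frag_extend_cmul)
  show "a \<otimes>\<^bsub>group_ring G\<^esub> frag_cmul c b = frag_cmul c (a \<otimes>\<^bsub>group_ring G\<^esub> b)"
    by (simp add: group_ring_simps frag_extend_cmul *)
qed

lemma group_ring_mult_uminus:
  "(- a) \<otimes>\<^bsub>group_ring G\<^esub> b = - (a \<otimes>\<^bsub>group_ring G\<^esub> b)"
  "a \<otimes>\<^bsub>group_ring G\<^esub> (- b) = - (a \<otimes>\<^bsub>group_ring G\<^esub> b)"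
  using frag_cmul_mult[where c = "-1"] by simp_all

lemma group_ring_mult_sum:
  "(\<Sum>i\<in>I. f i) \<otimes>\<^bsub>group_ring G\<^esub> b = (\<Sum>i\<in>I. f i \<otimes>\<^bsub>group_ring G\<^esub> b)"
  "b \<otimes>\<^bsub>group_ring G\<^esub> (\<Sum>i\<in>I. f i) = (\<Sum>i\<in>I. b \<otimes>\<^bsub>group_ring G\<^esub> f i)"
  by (induction I rule: infinite_finite_induct) (simp_all add: group_ring_mult_add)

text \<open>
  For an additive map out of a group ring, multiplicativity need only be checked on group elements.
  The multiplication of the target is a parameter because the targets below are integers, quaternions
  encoded as tuples, and other group rings.
\<close>

lemma additive_map_mult:
  fixes F :: "('a \<Rightarrow>\<^sub>0 int) \<Rightarrow> 'b :: ab_group_add"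
  assumes F: "\<And>a b. F (a - b) = F a - F b"
    and op_left: "\<And>p q r. mul (p - q) r = mul p r - mul q r"
    and op_right: "\<And>p q r. mul r (p - q) = mul r p - mul r q"
    and F_mult: "\<And>x y. x \<in> H \<Longrightarrow> y \<in> H \<Longrightarrow>
          F (frag_of (x \<otimes>\<^bsub>G\<^esub> y)) = mul (F (frag_of x)) (F (frag_of y))"
    and a: "Poly_Mapping.keys a \<subseteq> H" and b: "Poly_Mapping.keys b \<subseteq> H"
  shows "F (a \<otimes>\<^bsub>group_ring G\<^esub> b) = mul (F a) (F b)"
proof -
  have F0: "F 0 = 0" using F[of 0 0] by simp
  have z: "mul 0 r = 0" "mul r 0 = 0" for r
    using op_left[of 0 0 r] op_right[of r 0 0] by simp_all
  show ?thesis using a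
  proof (induction a rule: frag_induction)
    case (one x)
    show ?case using b
      by (induction b rule: frag_induction)
         (simp_all add: F0 z F op_right group_ring_mult_diff F_mult one)
  qed (simp_all add: F0 z F op_left group_ring_mult_diff)
qed

lemma units_group_ring_iff:
  assumes "monoid G"
  shows "u \<in> Units (group_ring G) \<longleftrightarrow>
    Poly_Mapping.keys u \<subseteq> carrier G \<and> (\<exists>v. Poly_Mapping.keys v \<subseteq> carrier G \<and>
      u \<otimes>\<^bsub>group_ring G\<^esub> v = frag_of \<one>\<^bsub>G\<^esub> \<and> v \<otimes>\<^bsub>group_ring G\<^esub> u = frag_of \<one>\<^bsub>G\<^esub>)"
  by (auto simp: Units_def group_ring_simps(1,3))

lemma augmentation_uminus: "augmentation (- a) = - augmentation a"
  using augmentation_diff[of 0 a] by simp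

lemma augmentation_cmul: "augmentation (frag_cmul c a) = c * augmentation a"
  using augmentation_eq_sum[of "Poly_Mapping.keys a" "frag_cmul c a"] keys_cmul[of c a]
  by (simp add: augmentation_def sum_distrib_left)

lemma augmentation_unit:
  assumes "monoid G" "u \<in> Units (group_ring G)"
  shows "augmentation u = 1 \<or> augmentation u = -1"
proof -
  obtain v where "u \<otimes>\<^bsub>group_ring G\<^esub> v = frag_of \<one>\<^bsub>G\<^esub>"
    using assms units_group_ring_iff by blast
  then have "augmentation u * augmentation v = 1"
    by (metis augmentation_mult augmentation_frag_of)
  then show ?thesis by (simp add: zmult_eq_1_iff) blast
qed

section \<open>Powers of the augmentation ideal\<close>

lemma augmentation_ideal_iff:
  "a \<in> augmentation_ideal G \<longleftrightarrow> Poly_Mapping.keys a \<subseteq> carrier G \<and> augmentation a = 0"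
  by (auto simp: augmentation_ideal_def a_kernel_def' group_ring_simps)

lemma ideal_augmentation_ideal_power:
  assumes "monoid G"
  shows "ideal (augmentation_ideal_power G n) (group_ring G)"
proof (induction n)
  case 0
  show ?case
    by (simp add: augmentation_ideal_power_0 ring.oneideal[OF ring_group_ring[OF assms]])
next
  case (Suc n)
  then show ?case
    by (simp add: augmentation_ideal_power_Suc ideal_augmentation_ideal[OF assms]
        ring.ideal_prod_is_ideal[OF ring_group_ring[OF assms]])
qed

lemma augmentation_ideal_power_add:
  assumes "monoid G" "a \<in> augmentation_ideal_power G n" "b \<in> augmentation_ideal_power G n"
  shows "a + b \<in> augmentation_ideal_power G n"
  using additive_subgroup.a_closed[OF ideal.axioms(1)[OF ideal_augmentation_ideal_power[OF assms(1)]] assms(2,3)]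
  by (simp add: group_ring_simps)

lemma augmentation_ideal_power_mult_right:
  assumes "monoid G" "a \<in> augmentation_ideal_power G n" "Poly_Mapping.keys b \<subseteq> carrier G"
  shows "a \<otimes>\<^bsub>group_ring G\<^esub> b \<in> augmentation_ideal_power G n"
  using ideal.I_r_closed[OF ideal_augmentation_ideal_power[OF assms(1)] assms(2)] assms(3)
  by (simp add: group_ring_simps(1))

lemma augmentation_ideal_power_keys:
  assumes "monoid G" "a \<in> augmentation_ideal_power G n"
  shows "Poly_Mapping.keys a \<subseteq> carrier G"
  using ideal.Icarr[OF ideal_augmentation_ideal_power[OF assms(1)] assms(2)]
  by (simp add: group_ring_simps(1))

lemma augmentation_ideal_power_cmul:
  assumes "group G" "a \<in> augmentation_ideal_power G n"
  shows "frag_cmul c a \<in> augmentation_ideal_power G n"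
proof -
  interpret group G by fact
  have k: "Poly_Mapping.keys a \<subseteq> carrier G"
    using augmentation_ideal_power_keys[OF monoid_axioms assms(2)] .
  have "frag_cmul c a = a \<otimes>\<^bsub>group_ring G\<^esub> frag_cmul c (frag_of \<one>\<^bsub>G\<^esub>)"
    using group_ring_one(2)[OF monoid_axioms k] by (simp add: frag_cmul_mult)
  moreover have "Poly_Mapping.keys (frag_cmul c (frag_of \<one>\<^bsub>G\<^esub>)) \<subseteq> carrier G"
    using keys_cmul[of c "frag_of \<one>\<^bsub>G\<^esub>"] by auto
  ultimately show ?thesis
    using augmentation_ideal_power_mult_right[OF monoid_axioms assms(2)] by metis
qed

lemma augmentation_ideal_power_1:
  assumes "monoid G"
  shows "augmentation_ideal_power G 1 = augmentation_ideal G"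
proof
  interpret R: ring "group_ring G" by (rule ring_group_ring[OF assms])
  have I: "ideal (augmentation_ideal G) (group_ring G)" by (rule ideal_augmentation_ideal[OF assms])
  have *: "augmentation_ideal_power G 1 =
      carrier (group_ring G) \<cdot>\<^bsub>group_ring G\<^esub> augmentation_ideal G"
    using augmentation_ideal_power_Suc[of G 0] by (simp add: augmentation_ideal_power_0)
  show "augmentation_ideal_power G 1 \<subseteq> augmentation_ideal G"
    unfolding * using R.ideal_prod_inter[OF R.oneideal I] by blast
  show "augmentation_ideal G \<subseteq> augmentation_ideal_power G 1"
  proof
    fix a assume a: "a \<in> augmentation_ideal G"
    then have "\<one>\<^bsub>group_ring G\<^esub> \<otimes>\<^bsub>group_ring G\<^esub> a \<in> augmentation_ideal_power G 1"
      unfolding * by (intro ideal_prod.prod) auto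
    then show "a \<in> augmentation_ideal_power G 1"
      using ideal.Icarr[OF I a] by simp
  qed
qed

lemma augmentation_ideal_power_mult:
  assumes "a \<in> augmentation_ideal_power G n" "b \<in> augmentation_ideal G"
  shows "a \<otimes>\<^bsub>group_ring G\<^esub> b \<in> augmentation_ideal_power G (Suc n)"
  unfolding augmentation_ideal_power_Suc using assms by (rule ideal_prod.prod)

lemma augmentation_ideal_power_antimono:
  assumes "monoid G" "m \<le> n"
  shows "augmentation_ideal_power G n \<subseteq> augmentation_ideal_power G m"
  using assms(2)
proof (induction n rule: dec_induct)
  case (step n)
  have "augmentation_ideal_power G (Suc n) \<subseteq> augmentation_ideal_power G n"
    unfolding augmentation_ideal_power_Suc
    using ring.ideal_prod_inter[OF ring_group_ring[OF assms(1)]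
        ideal_augmentation_ideal_power[OF assms(1)] ideal_augmentation_ideal[OF assms(1)]]
    by blast
  then show ?case using step by blast
qed simp

lemma augmentation_ideal_power_induct [consumes 1, case_names mult add]:
  assumes "a \<in> augmentation_ideal_power G (Suc n)"
    and "\<And>b c. b \<in> augmentation_ideal_power G n \<Longrightarrow> c \<in> augmentation_ideal G \<Longrightarrow>
           P (b \<otimes>\<^bsub>group_ring G\<^esub> c)"
    and "\<And>b c. P b \<Longrightarrow> P c \<Longrightarrow> P (b + c)"
  shows "P a"
  using assms(1) unfolding augmentation_ideal_power_Suc
  by (induction rule: ideal_prod.induct) (use assms(2,3) in \<open>auto simp: group_ring_simps(5)\<close>)

lemma congruence_units_iff:
  assumes "monoid G"
  shows "u \<in> congruence_units G n \<longleftrightarrow>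
    u \<in> normalized_units G \<and> u - frag_of \<one>\<^bsub>G\<^esub> \<in> augmentation_ideal_power G n"
  by (auto simp: congruence_units_def a_l_coset_def' group_ring_simps(3,5) image_iff
      intro!: bexI[of _ "u - frag_of \<one>\<^bsub>G\<^esub>"])

context group
begin

interpretation ZG: ring "group_ring G"
  by (rule ring_group_ring) (rule monoid_axioms)

abbreviation gmult (infixl "\<star>" 70)
  where "a \<star> b \<equiv> a \<otimes>\<^bsub>group_ring G\<^esub> b"

abbreviation gpow (infixr "^^^" 75)
  where "a ^^^ n \<equiv> a [^]\<^bsub>group_ring G\<^esub> (n::nat)"

lemma group_ring_carrier_iff: "a \<in> carrier (group_ring G) \<longleftrightarrow> Poly_Mapping.keys a \<subseteq> carrier G"
  by (simp add: group_ring_simps)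

lemma group_ring_one_eq: "\<one>\<^bsub>group_ring G\<^esub> = frag_of \<one>"
  by (simp add: group_ring_simps)

lemma group_ring_carrier_intros [simp, intro]:
  "x \<in> carrier G \<Longrightarrow> frag_of x \<in> carrier (group_ring G)"
  "a \<in> carrier (group_ring G) \<Longrightarrow> b \<in> carrier (group_ring G) \<Longrightarrow> a + b \<in> carrier (group_ring G)"
  "a \<in> carrier (group_ring G) \<Longrightarrow> b \<in> carrier (group_ring G) \<Longrightarrow> a - b \<in> carrier (group_ring G)"
  "a \<in> carrier (group_ring G) \<Longrightarrow> - a \<in> carrier (group_ring G)"
  "0 \<in> carrier (group_ring G)"
  "a \<in> carrier (group_ring G) \<Longrightarrow> frag_cmul c a \<in> carrier (group_ring G)"
  using keys_add[of a b] keys_diff[of a b] keys_cmul[of c a]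
  by (auto simp: group_ring_carrier_iff)

lemma group_ring_carrier_sum [intro]:
  "(\<And>i. i \<in> I \<Longrightarrow> f i \<in> carrier (group_ring G)) \<Longrightarrow> (\<Sum>i\<in>I. f i) \<in> carrier (group_ring G)"
  by (induction I rule: infinite_finite_induct) auto

lemma group_ring_one_mult [simp]:
  "a \<in> carrier (group_ring G) \<Longrightarrow> frag_of \<one> \<star> a = a"
  "a \<in> carrier (group_ring G) \<Longrightarrow> a \<star> frag_of \<one> = a"
  using ZG.l_one ZG.r_one by (simp_all add: group_ring_one_eq)

lemma gpow_frag_of: "x \<in> carrier G \<Longrightarrow> frag_of x ^^^ n = frag_of (x [^] n)"
  by (induction n) (simp_all add: group_ring_one_eq)

lemma augmentation_gpow: "augmentation (u ^^^ n) = augmentation u ^ n"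
  by (induction n) (simp_all add: group_ring_one_eq augmentation_mult)

lemma nat_pow_mod:
  assumes "x \<in> carrier G" "x [^] (n::nat) = \<one>"
  shows "x [^] k = x [^] (k mod n)"
proof -
  have "x [^] k = x [^] (n * (k div n)) \<otimes> x [^] (k mod n)"
    using assms(1) by (simp add: nat_pow_mult)
  then show ?thesis
    using assms by (simp add: nat_pow_pow[symmetric])
qed

text \<open>
  In the binomial expansion of \<open>(1 + d)^m\<close> every term after \<open>m d\<close> contains \<open>d\<^sup>2\<close>, which lies in
  \<open>\<Delta>^(j+1)\<close> since \<open>d\<close> is in \<open>\<Delta>^j\<close> and also in \<open>\<Delta>\<close>.
\<close>

lemma one_plus_pow_mod_augmentation_ideal_power:
  assumes d: "d \<in> augmentation_ideal_power G j" and j: "j \<ge> 1"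
  shows "(frag_of \<one> + d) ^^^ m - frag_of \<one> - frag_cmul (int m) d \<in> augmentation_ideal_power G (Suc j)"
proof (induction m)
  case 0
  show ?case
    using additive_subgroup.zero_closed[OF ideal.axioms(1)[OF ideal_augmentation_ideal_power[OF monoid_axioms]]]
    by (simp add: group_ring_one_eq group_ring_simps(4))
next
  case (Suc m)
  define e where "e = (frag_of \<one> + d) ^^^ m - frag_of \<one> - frag_cmul (int m) d"
  have d': "d \<in> augmentation_ideal G"
    using augmentation_ideal_power_antimono[OF monoid_axioms j] d
      augmentation_ideal_power_1[OF monoid_axioms] by blast
  have dc: "d \<in> carrier (group_ring G)"
    using augmentation_ideal_power_keys[OF monoid_axioms d] by (simp add: group_ring_carrier_iff)
  have ec: "e \<in> carrier (group_ring G)"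
    using augmentation_ideal_power_keys[OF monoid_axioms Suc] by (simp add: group_ring_carrier_iff e_def)
  have "(frag_of \<one> + d) ^^^ Suc m = (frag_of \<one> + frag_cmul (int m) d + e) \<star> (frag_of \<one> + d)"
    by (simp add: e_def)
  also have "\<dots> = frag_of \<one> + frag_cmul (int (Suc m)) d + (e + e \<star> d + frag_cmul (int m) (d \<star> d))"
    using dc ec by (simp add: group_ring_mult_add frag_cmul_mult frag_cmul_distrib)
  finally have *: "(frag_of \<one> + d) ^^^ Suc m - frag_of \<one> - frag_cmul (int (Suc m)) d =
      e + e \<star> d + frag_cmul (int m) (d \<star> d)"
    by simp
  have "e \<in> augmentation_ideal_power G (Suc j)" using Suc by (simp add: e_def)
  then show ?case unfolding *
    using dc d d' by (intro augmentation_ideal_power_add augmentation_ideal_power_mult_right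
        augmentation_ideal_power_cmul augmentation_ideal_power_mult monoid_axioms group_axioms)
      (simp_all add: group_ring_carrier_iff)
qed

text \<open>
  The differences \<open>g - 1\<close> span \<open>\<Delta>\<close>: subtracting its augmentation from any element leaves
  a combination of them.
\<close>

lemma augmentation_ideal_induct [consumes 1, case_names zero gen diff]:
  assumes "a \<in> augmentation_ideal G"
    and zero: "P 0"
    and gen: "\<And>g. g \<in> carrier G \<Longrightarrow> P (frag_of g - frag_of \<one>)"
    and diff: "\<And>a b. P a \<Longrightarrow> P b \<Longrightarrow> P (a - b)"
  shows "P a"
proof -
  have "Poly_Mapping.keys a \<subseteq> carrier G" and aug: "augmentation a = 0"
    using assms(1) by (auto simp: augmentation_ideal_iff)
  from this(1) have "P (a - frag_cmul (augmentation a) (frag_of \<one>))"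
  proof (induction a rule: frag_induction)
    case (diff a b)
    have "a - b - frag_cmul (augmentation (a - b)) (frag_of \<one>) =
       (a - frag_cmul (augmentation a) (frag_of \<one>)) - (b - frag_cmul (augmentation b) (frag_of \<one>))"
      by (simp add: augmentation_diff frag_cmul_diff_distrib)
    then show ?case using assms(4)[OF diff] by presburger
  qed (use zero gen in auto)
  then show ?thesis by (simp add: aug)
qed

text \<open>
  Expanding \<open>1 = g^|G| = (1 + (g - 1))^|G|\<close> gives \<open>|G| (g - 1) \<in> \<Delta>\<^sup>2\<close>; multiplication by further
  elements of \<open>\<Delta>\<close> raises both exponents.
\<close>

lemma order_cmul_augmentation_ideal_power:
  assumes fin: "finite (carrier G)" and a: "a \<in> augmentation_ideal_power G (Suc j)"
  shows "frag_cmul (int (Coset.order G)) a \<in> augmentation_ideal_power G (Suc (Suc j))"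
  using a
proof (induction j arbitrary: a)
  case 0
  then have "a \<in> augmentation_ideal G"
    using augmentation_ideal_power_1[OF monoid_axioms] by simp
  then show ?case
  proof (induction a rule: augmentation_ideal_induct)
    case zero
    show ?case
      using additive_subgroup.zero_closed[OF ideal.axioms(1)[OF ideal_augmentation_ideal_power[OF monoid_axioms]]]
      by (simp add: group_ring_simps(4))
  next
    case (gen g)
    have d: "frag_of g - frag_of \<one> \<in> augmentation_ideal_power G 1"
      using gen by (simp only: augmentation_ideal_power_1[OF monoid_axioms])
        (auto simp: augmentation_ideal_iff augmentation_diff simp flip: group_ring_carrier_iff)
    have "(frag_of \<one> + (frag_of g - frag_of \<one>)) ^^^ Coset.order G - frag_of \<one> = 0"
      using gen by (simp add: gpow_frag_of pow_order_eq_1)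
    then have "- frag_cmul (int (Coset.order G)) (frag_of g - frag_of \<one>) \<in> augmentation_ideal_power G (Suc 1)"
      using one_plus_pow_mod_augmentation_ideal_power[OF d, of "Coset.order G"] by simp
    from augmentation_ideal_power_cmul[OF group_axioms this, of "-1"]
    show ?case by (simp add: numeral_2_eq_2)
  next
    case (diff a b)
    have "frag_cmul (int (Coset.order G)) (a - b) = frag_cmul (int (Coset.order G)) a + frag_cmul (-1) (frag_cmul (int (Coset.order G)) b)"
      using frag_cmul_distrib2[of "int (Coset.order G)" "a-b" b]  by (simp add: algebra_simps del: frag_cmul_cmul minus_frag_cmul)
    then show ?case
      using diff by (auto intro!: augmentation_ideal_power_add augmentation_ideal_power_cmul monoid_axioms group_axioms
         simp del: frag_cmul_cmul frag_cmul_minus_one)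
  qed
next
  case (Suc j)
  from Suc.prems show ?case
  proof (induction a rule: augmentation_ideal_power_induct)
    case (mult b c)
    then show ?case
      using augmentation_ideal_power_mult[OF Suc.IH[OF mult(1)] mult(2)] by (simp add: frag_cmul_mult)
  next
    case (add b c)
    then show ?case
      by (auto simp: frag_cmul_distrib2 intro!: augmentation_ideal_power_add monoid_axioms)
  qed
qed

lemma normalized_units_pow:
  assumes "u \<in> normalized_units G"
  shows "u ^^^ k \<in> normalized_units G"
  using assms by (simp add: normalized_units_def augmentation_gpow ZG.Units_pow_closed)

text \<open>
  If \<open>w = 1 + d\<close> with \<open>d \<in> \<Delta>^j\<close>, then \<open>w^|G|\<close> is \<open>1 + |G| d\<close> modulo \<open>\<Delta>^(j+1)\<close>, and the term
  \<open>|G| d\<close> vanishes there as well. So raising to the power \<open>|G|\<close> goes one step down the filtration.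
\<close>

lemma normalized_unit_pow_congruence:
  assumes fin: "finite (carrier G)" and u: "u \<in> normalized_units G"
  shows "u ^^^ (Coset.order G ^ j) \<in> congruence_units G (Suc j)"
proof (induction j)
  case 0
  have "u \<in> carrier (group_ring G)" using u by (auto simp: normalized_units_def)
  moreover from this have "u - frag_of \<one> \<in> augmentation_ideal_power G 1"
    using u by (simp only: augmentation_ideal_power_1[OF monoid_axioms])
        (auto simp: augmentation_ideal_iff augmentation_diff normalized_units_def simp flip: group_ring_carrier_iff)
  ultimately show ?case
    using u by (simp add: congruence_units_iff[OF monoid_axioms])
next
  case (Suc j)
  define w where "w = u ^^^ (Coset.order G ^ j)"
  have uc: "u \<in> carrier (group_ring G)" using u by (auto simp: normalized_units_def)
  have w: "w - frag_of \<one> \<in> augmentation_ideal_power G (Suc j)"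
    using Suc by (simp add: congruence_units_iff[OF monoid_axioms] w_def)
  have "w ^^^ Coset.order G - frag_of \<one> - frag_cmul (int (Coset.order G)) (w - frag_of \<one>)
      \<in> augmentation_ideal_power G (Suc (Suc j))"
    using one_plus_pow_mod_augmentation_ideal_power[OF w, of "Coset.order G"] by simp
  from augmentation_ideal_power_add[OF monoid_axioms this order_cmul_augmentation_ideal_power[OF fin w]]
  have "w ^^^ Coset.order G - frag_of \<one> \<in> augmentation_ideal_power G (Suc (Suc j))" by simp
  moreover have "w ^^^ Coset.order G = u ^^^ (Coset.order G ^ Suc j)"
    unfolding w_def using uc by (simp add: ZG.nat_pow_pow mult.commute)
  ultimately show ?case
    using normalized_units_pow[OF u] by (simp add: congruence_units_iff[OF monoid_axioms])
qed

lemma torsion_of_congruence_units_trivial: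
  assumes fin: "finite (carrier G)" and n: "n \<ge> 1" "congruence_units G n = {\<one>\<^bsub>group_ring G\<^esub>}"
  shows "\<exists>m\<ge>1. \<forall>u\<in>normalized_units G. u ^^^ m = frag_of \<one>"
proof -
  have "Coset.order G \<ge> 1" using fin by (simp add: Suc_le_eq order_gt_0_iff_finite)
  then have "Coset.order G ^ (n - 1) \<ge> 1" by simp
  moreover have "u ^^^ (Coset.order G ^ (n - 1)) = frag_of \<one>" if "u \<in> normalized_units G" for u
    using normalized_unit_pow_congruence[OF fin that, of "n - 1"] n by (simp add: group_ring_one_eq)
  ultimately show ?thesis by blast
qed

end

section \<open>Units of finite order in commutative group rings\<close>

text \<open>
  The anti-automorphism inverting the group elements. It is the adjoint for the trace form, whose
  value at \<open>a\<close> and \<open>b\<close> is the coefficient of the group identity in \<open>a b\<^sup>*\<close>.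
\<close>

definition involution :: "('a, 'b) monoid_scheme \<Rightarrow> ('a \<Rightarrow>\<^sub>0 int) \<Rightarrow> ('a \<Rightarrow>\<^sub>0 int)" where
  "involution G a = frag_extend (\<lambda>x. frag_of (inv\<^bsub>G\<^esub> x)) a"

context group
begin

interpretation ZG: ring "group_ring G"
  by (rule ring_group_ring) (rule monoid_axioms)

lemma lookup_frag_of_mult:
  assumes "y \<in> carrier G" "g \<in> carrier G" "b \<in> carrier (group_ring G)"
  shows "Poly_Mapping.lookup (frag_of y \<star> b) g = Poly_Mapping.lookup b (inv y \<otimes> g)"
  using assms(3) unfolding group_ring_carrier_iff
proof (induction b rule: frag_induction)
  case (one z)
  have "g = y \<otimes> z \<longleftrightarrow> inv y \<otimes> g = z"
    using assms one inv_solve_left by metis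
  then show ?case by auto
qed (auto simp: group_ring_mult_diff lookup_minus)

lemma lookup_involution:
  assumes "x \<in> carrier G" "a \<in> carrier (group_ring G)"
  shows "Poly_Mapping.lookup (involution G a) x = Poly_Mapping.lookup a (inv x)"
  using assms(2) unfolding group_ring_carrier_iff involution_def
proof (induction a rule: frag_induction)
  case (one z)
  have "x = inv z \<longleftrightarrow> inv x = z" using assms(1) one by auto
  then show ?case by auto
qed (auto simp: frag_extend_diff lookup_minus)

lemma involution_closed:
  assumes "a \<in> carrier (group_ring G)"
  shows "involution G a \<in> carrier (group_ring G)"
  using assms unfolding group_ring_carrier_iff involution_def
  by (intro order_trans[OF keys_frag_extend]) auto

text \<open>
  The trace form is the standard inner product of coefficient vectors. In particular it is positive
  definite, which is what makes units of finite order accessible.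
\<close>

lemma trace_mult_involution:
  assumes fin: "finite (carrier G)" and a: "a \<in> carrier (group_ring G)"
  shows "Poly_Mapping.lookup (a \<star> involution G a) \<one> = (\<Sum>x\<in>carrier G. (Poly_Mapping.lookup a x)\<^sup>2)"
proof -
  have bil: "Poly_Mapping.lookup (a \<star> involution G c) \<one> =
      (\<Sum>x\<in>carrier G. Poly_Mapping.lookup a x * Poly_Mapping.lookup c x)"
    if c: "c \<in> carrier (group_ring G)" for c
    using a unfolding group_ring_carrier_iff
  proof (induction a rule: frag_induction)
    case (one y)
    have "(\<Sum>x\<in>carrier G. (if x = y then 1 else 0) * Poly_Mapping.lookup c x) = Poly_Mapping.lookup c y"
      using fin one by (simp add: if_distrib[of "\<lambda>t. t * _"] cong: if_cong)
    then show ?case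
      using one c by (simp add: lookup_frag_of_mult lookup_involution involution_closed)
  qed (simp_all add: group_ring_mult_diff lookup_minus left_diff_distrib sum_subtractf)
  show ?thesis using bil[OF a] by (simp add: power2_eq_square)
qed

end

lemma (in comm_group) cring_group_ring: "cring (group_ring G)"
proof (rule cringI)
  interpret ZG: ring "group_ring G" by (rule ring_group_ring) (rule monoid_axioms)
  show "abelian_group (group_ring G)" by (rule ZG.abelian_group_axioms)
  show "comm_monoid (group_ring G)"
  proof (rule ZG.monoid_comm_monoidI)
    fix a b assume "a \<in> carrier (group_ring G)" and b: "b \<in> carrier (group_ring G)"
    then have "Poly_Mapping.keys a \<subseteq> carrier G" by (simp add: group_ring_carrier_iff)
    then show "a \<star> b = b \<star> a"
    proof (induction a rule: frag_induction)
      case (one x)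
      from b have "Poly_Mapping.keys b \<subseteq> carrier G" by (simp add: group_ring_carrier_iff)
      then show ?case
        by (induction b rule: frag_induction)
           (auto simp: group_ring_mult_diff m_comm one)
    qed (auto simp: group_ring_mult_diff)
  qed
qed (simp_all add: group_ring_mult_add group_ring_simps(5))

lemma int_sum_squares_eq_1:
  fixes f :: "'a \<Rightarrow> int"
  assumes "finite A" "(\<Sum>x\<in>A. (f x)\<^sup>2) = 1"
  obtains x where "x \<in> A" "f x = 1 \<or> f x = -1" "\<And>y. y \<in> A \<Longrightarrow> y \<noteq> x \<Longrightarrow> f y = 0"
proof -
  obtain x where x: "x \<in> A" "f x \<noteq> 0"
    using assms(2) sum.neutral[of A "\<lambda>x. (f x)\<^sup>2"] by fastforce
  have "(f x)\<^sup>2 + (\<Sum>y\<in>A - {x}. (f y)\<^sup>2) = 1"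
    using assms x by (simp add: sum.remove)
  moreover have "(f x)\<^sup>2 \<ge> 1" using x by (simp add: int_one_le_iff_zero_less)
  moreover have nn: "(\<Sum>y\<in>A - {x}. (f y)\<^sup>2) \<ge> 0" by (simp add: sum_nonneg)
  ultimately have 1: "(f x)\<^sup>2 = 1" "(\<Sum>y\<in>A - {x}. (f y)\<^sup>2) = 0" by auto
  have "\<forall>y\<in>A - {x}. (f y)\<^sup>2 = 0"
    using 1(2) assms(1) by (subst (asm) sum_nonneg_eq_0_iff) auto
  moreover have "f x = 1 \<or> f x = -1" using 1(1) by (simp add: power2_eq_1_iff)
  ultimately show ?thesis using that x by auto
qed

lemma trivial_unit_of_sum_squares:
  assumes "finite A" "Poly_Mapping.keys u \<subseteq> A"
    and "(\<Sum>x\<in>A. (Poly_Mapping.lookup u x)\<^sup>2) = 1"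
  shows "\<exists>g\<in>A. u = frag_of g \<or> u = - frag_of g"
proof -
  obtain g where g: "g \<in> A" "Poly_Mapping.lookup u g = 1 \<or> Poly_Mapping.lookup u g = -1"
    "\<And>y. y \<in> A \<Longrightarrow> y \<noteq> g \<Longrightarrow> Poly_Mapping.lookup u y = 0"
    using int_sum_squares_eq_1[OF assms(1,3)] by blast
  have 0: "Poly_Mapping.lookup u y = 0" if "y \<noteq> g" for y
    using g(3)[of y] that assms(2) by (cases "y \<in> A") (auto simp: in_keys_iff)
  have "u = frag_of g \<or> u = - frag_of g"
    using g(2)
  proof
    assume "Poly_Mapping.lookup u g = 1"
    then have "u = frag_of g" by (intro poly_mapping_eqI) (simp add: 0)
    then show ?thesis ..
  next
    assume "Poly_Mapping.lookup u g = -1"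
    then have "u = - frag_of g" by (intro poly_mapping_eqI) (simp add: 0)
    then show ?thesis ..
  qed
  with g(1) show ?thesis by blast
qed

context comm_group
begin

interpretation ZG: cring "group_ring G"
  by (rule cring_group_ring)

lemma involution_mult:
  assumes "a \<in> carrier (group_ring G)" "b \<in> carrier (group_ring G)"
  shows "involution G (a \<star> b) = involution G a \<star> involution G b"
proof (rule additive_map_mult[where F = "involution G" and mul = "(\<star>)" and H = "carrier G"])
  show "Poly_Mapping.keys a \<subseteq> carrier G" "Poly_Mapping.keys b \<subseteq> carrier G"
    using assms by (simp_all add: group_ring_carrier_iff)
qed (simp_all add: involution_def frag_extend_diff group_ring_mult_diff inv_mult)

text \<open>
  The element \<open>w = u u\<^sup>*\<close> is positive and of finite order, which forces \<open>w = 1\<close>. To see this without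
  spectral theory put \<open>z = w - 1\<close>. The sum of \<open>w^k z\<close> over \<open>k < m\<close> telescopes to \<open>w^m - 1 = 0\<close>, whereas
  the trace of \<open>w^k z z\<^sup>* = (u^k z) (u^k z)\<^sup>*\<close> is a sum of squares. So all these squares vanish, and
  \<open>k = 0\<close> gives \<open>z = 0\<close>. Now \<open>u u\<^sup>* = 1\<close> says that the squares of the integer coefficients of \<open>u\<close>
  add up to one.
\<close>

lemma torsion_unit_trivial:
  assumes fin: "finite (carrier G)" and u: "u \<in> carrier (group_ring G)"
    and m: "m \<ge> 1" "u ^^^ m = frag_of \<one>"
  shows "\<exists>g\<in>carrier G. u = frag_of g \<or> u = - frag_of g"
proof -
  define w where "w = u \<star> involution G u"
  define z where "z = w - frag_of \<one>"
  have u': "involution G u \<in> carrier (group_ring G)" using u by (rule involution_closed)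
  have wc: "w \<in> carrier (group_ring G)" unfolding w_def using u u' by (rule ZG.m_closed)
  have zc: "z \<in> carrier (group_ring G)" unfolding z_def using wc by simp
  have z': "involution G z \<in> carrier (group_ring G)" using zc by (rule involution_closed)
  have inv_pow: "involution G (u ^^^ k) = involution G u ^^^ k" for k
    by (induction k) (simp_all add: u involution_mult, simp add: group_ring_one_eq involution_def)
  have wk: "w ^^^ k = u ^^^ k \<star> involution G (u ^^^ k)" for k
    unfolding w_def inv_pow using u u' by (rule ZG.nat_pow_distrib)
  have wm: "w ^^^ m = frag_of \<one>"
    unfolding wk m(2) by (simp add: involution_def)
  have norm_term: "Poly_Mapping.lookup (w ^^^ k \<star> (z \<star> involution G z)) \<one> =
      (\<Sum>x\<in>carrier G. (Poly_Mapping.lookup (u ^^^ k \<star> z) x)\<^sup>2)" for k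
  proof -
    have "w ^^^ k \<star> (z \<star> involution G z) = (u ^^^ k \<star> z) \<star> involution G (u ^^^ k \<star> z)"
      using u zc z' involution_closed[of "u ^^^ k"] unfolding wk
      by (simp add: involution_mult ZG.m_ac)
    then show ?thesis using trace_mult_involution[OF fin, of "u ^^^ k \<star> z"] u zc by simp
  qed
  have tele: "(\<Sum>k<m. w ^^^ k \<star> z) = 0"
  proof -
    have "(\<Sum>k<m. w ^^^ k \<star> z) = (\<Sum>k<m. w ^^^ Suc k - w ^^^ k)"
      using wc by (intro sum.cong) (simp_all add: z_def group_ring_mult_diff)
    also have "\<dots> = w ^^^ m - w ^^^ 0" by (rule sum_lessThan_telescope)
    finally show ?thesis by (simp add: wm group_ring_one_eq)
  qed
  have "0 = Poly_Mapping.lookup ((\<Sum>k<m. w ^^^ k \<star> z) \<star> involution G z) \<one>"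
    by (simp add: tele)
  also have "\<dots> = (\<Sum>k<m. Poly_Mapping.lookup (w ^^^ k \<star> (z \<star> involution G z)) \<one>)"
    using wc zc z' by (simp add: group_ring_mult_sum lookup_sum ZG.m_assoc)
  also have "\<dots> = (\<Sum>k<m. \<Sum>x\<in>carrier G. (Poly_Mapping.lookup (u ^^^ k \<star> z) x)\<^sup>2)"
    by (simp add: norm_term)
  finally have "\<forall>k\<in>{..<m}. (\<Sum>x\<in>carrier G. (Poly_Mapping.lookup (u ^^^ k \<star> z) x)\<^sup>2) = 0"
    by (subst (asm) eq_commute, subst (asm) sum_nonneg_eq_0_iff) (auto intro: sum_nonneg)
  \<comment> \<open>Positivity is used here: \<open>m \<ge> 1\<close> makes \<open>k = 0\<close> one of the vanishing summands.\<close>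
  then have "(\<Sum>x\<in>carrier G. (Poly_Mapping.lookup (u ^^^ 0 \<star> z) x)\<^sup>2) = 0"
    by (rule bspec) (use m(1) in simp)
  then have "\<forall>x\<in>carrier G. Poly_Mapping.lookup z x = 0"
    using zc fin by (subst (asm) sum_nonneg_eq_0_iff) (auto simp: group_ring_one_eq)
  then have "z = 0"
    using zc by (intro poly_mapping_eqI) (auto simp: group_ring_carrier_iff in_keys_iff)
  then have "u \<star> involution G u = frag_of \<one>" by (simp add: z_def w_def)
  then have "(\<Sum>x\<in>carrier G. (Poly_Mapping.lookup u x)\<^sup>2) = 1"
    using trace_mult_involution[OF fin u] by simp
  then show ?thesis
    using trivial_unit_of_sum_squares[OF fin] u by (simp add: group_ring_carrier_iff)
qed

end

lemma (in comm_group) cut_group_of_units_torsion: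
  assumes fin: "finite (carrier G)"
    and tors: "m \<ge> 1" "\<forall>u\<in>normalized_units G. u ^^^ m = frag_of \<one>"
  shows "cut_group G"
  unfolding cut_group_def
proof (intro conjI ballI group_axioms)
  interpret ZG: cring "group_ring G" by (rule cring_group_ring)
  fix u assume "u \<in> central_units G"
  then have u: "u \<in> Units (group_ring G)" by (simp add: central_units_def)
  then have uc: "u \<in> carrier (group_ring G)" by (rule ZG.Units_closed)
  have "u ^^^ (2 * m) = frag_of \<one>"
  proof -
    have uu: "u \<star> u \<in> normalized_units G"
      using u augmentation_unit[OF monoid_axioms u]
      by (auto simp: normalized_units_def augmentation_mult)
    have "u ^^^ (2 * m) = (u ^^^ 2) ^^^ m" using uc by (simp add: ZG.nat_pow_pow)
    also have "u ^^^ 2 = u \<star> u" using uc by (simp add: numeral_2_eq_2)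
    finally show ?thesis using uu tors by simp
  qed
  then show "\<exists>g\<in>carrier G. u = frag_of g \<or> u = - frag_of g"
    using torsion_unit_trivial[OF fin uc, of "2 * m"] tors(1) by simp
qed

section \<open>Bicyclic units\<close>

context group
begin

interpretation ZG: ring "group_ring G"
  by (rule ring_group_ring) (rule monoid_axioms)

lemma gpow_one_plus_square_zero:
  assumes y: "y \<in> carrier (group_ring G)" "y \<star> y = 0"
  shows "(frag_of \<one> + y) ^^^ k = frag_of \<one> + frag_cmul (int k) y"
  using y by (induction k)
    (simp_all add: group_ring_one_eq group_ring_mult_add frag_cmul_mult frag_cmul_distrib)

text \<open>
  With \<open>S\<close> the sum of the elements of \<open>H\<close>, the element \<open>y = (a - 1) b S\<close> has \<open>y\<^sup>2 = 0\<close> because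
  \<open>S (a - 1) = 0\<close>. Hence \<open>1 + y\<close> is a unit, called bicyclic, with \<open>(1 + y)^m = 1 + m y\<close>; if it has
  finite order then \<open>y = 0\<close>, that is \<open>a b S = b S\<close>, and \<open>a b\<close> belongs to the coset \<open>b H\<close>.
\<close>

lemma coset_of_bicyclic_units_torsion:
  assumes fin: "finite (carrier G)" and H: "subgroup H G" and a: "a \<in> H" and b: "b \<in> carrier G"
    and tors: "m \<ge> 1" "\<forall>u\<in>normalized_units G. u ^^^ m = frag_of \<one>"
  shows "\<exists>h\<in>H. a \<otimes> b = b \<otimes> h"
proof -
  interpret H: subgroup H G by fact
  have finH: "finite H" using fin H.subset finite_subset by blast
  define S where "S = (\<Sum>h\<in>H. frag_of h)"
  define y where "y = (frag_of a - frag_of \<one>) \<star> (frag_of b \<star> S)"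
  have ac: "a \<in> carrier G" using a by simp
  have Sc: "S \<in> carrier (group_ring G)" unfolding S_def by auto
  have yc: "y \<in> carrier (group_ring G)" unfolding y_def using ac b Sc by simp
  have "S \<star> frag_of a = (\<Sum>h\<in>H. frag_of (h \<otimes> a))"
    by (simp add: S_def group_ring_mult_sum)
  also have "\<dots> = S" unfolding S_def
    by (rule sum.reindex_bij_witness[where i = "\<lambda>h. h \<otimes> inv a" and j = "\<lambda>h. h \<otimes> a"])
       (use a in \<open>auto simp: m_assoc\<close>)
  finally have "S \<star> (frag_of a - frag_of \<one>) = 0"
    using Sc by (simp add: group_ring_mult_diff)
  then have "(frag_of a - frag_of \<one>) \<star> (frag_of b \<star> (S \<star> (frag_of a - frag_of \<one>) \<star> (frag_of b \<star> S))) = 0"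
    by simp
  then have yy: "y \<star> y = 0"
    unfolding y_def using ac b Sc by (simp add: ZG.m_assoc)
  have aug: "augmentation (frag_of \<one> + y) = 1"
    by (simp add: augmentation_add y_def augmentation_mult augmentation_diff)
  have "frag_of \<one> + y \<in> normalized_units G"
    unfolding normalized_units_def
  proof (intro CollectI conjI aug)
    have "(frag_of \<one> + y) \<star> (frag_of \<one> - y) = frag_of \<one>"
      "(frag_of \<one> - y) \<star> (frag_of \<one> + y) = frag_of \<one>"
      using yc yy by (simp_all add: group_ring_mult_add group_ring_mult_diff)
    then show "frag_of \<one> + y \<in> Units (group_ring G)"
      using yc unfolding units_group_ring_iff[OF monoid_axioms] group_ring_carrier_iff[symmetric]
      by (intro conjI exI[of _ "frag_of \<one> - y"]) auto
  qed
  then have "frag_cmul (int m) y = 0"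
    using tors(2) gpow_one_plus_square_zero[OF yc yy, of m] by auto
  then have y0: "y = 0" using tors(1) by simp
  have "Poly_Mapping.lookup (frag_of (a \<otimes> b) \<star> S) (a \<otimes> b) = Poly_Mapping.lookup (frag_of b \<star> S) (a \<otimes> b)"
    using y0 ac b Sc by (simp add: y_def group_ring_mult_diff ZG.m_assoc[symmetric])
  then have "Poly_Mapping.lookup S \<one> = Poly_Mapping.lookup S (inv b \<otimes> (a \<otimes> b))"
    using ac b Sc by (simp add: lookup_frag_of_mult)
  moreover have S: "Poly_Mapping.lookup S x = (if x \<in> H then 1 else 0)" for x
    using finH by (simp add: S_def lookup_sum)
  ultimately have "inv b \<otimes> (a \<otimes> b) \<in> H" by (metis H.one_closed zero_neq_one)
  moreover have "b \<otimes> (inv b \<otimes> (a \<otimes> b)) = a \<otimes> b"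
    using ac b by (simp add: m_assoc[symmetric])
  ultimately show ?thesis by metis
qed

lemma conjugate_power_of_units_torsion:
  assumes fin: "finite (carrier G)" and a: "a \<in> carrier G" and b: "b \<in> carrier G"
    and tors: "m \<ge> 1" "\<forall>u\<in>normalized_units G. u ^^^ m = frag_of \<one>"
  shows "\<exists>k::nat. a \<otimes> b = b \<otimes> a [^] k"
proof -
  have "subgroup (generate G {a}) G" "a \<in> generate G {a}"
    using a by (auto intro: generate_is_subgroup generate.incl)
  from coset_of_bicyclic_units_torsion[OF fin this b tors]
  show ?thesis using generate_pow_on_finite_carrier[OF fin a] by auto
qed

end

section \<open>Bass cyclic units\<close>

text \<open>
  The quotient \<open>(x^n - 1) / (x - 1)\<close>, written as a sum so that it has the value \<open>n\<close> at \<open>x = 1\<close>.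
\<close>

definition pow_sum :: "nat \<Rightarrow> 'a::comm_semiring_1 \<Rightarrow> 'a" where
  "pow_sum n x = (\<Sum>t<n. x ^ t)"

lemma pow_sum_telescope:
  fixes x :: "'a::comm_ring_1"
  shows "(x - 1) * pow_sum n x = x ^ n - 1"
  unfolding pow_sum_def by (simp add: power_diff_1_eq)

lemma pow_sum_mult: "pow_sum i x * pow_sum j (x ^ i) = pow_sum (i * j) x"
proof -
  have "pow_sum (i * j) x = (\<Sum>t<j * i. x ^ t)" by (simp add: pow_sum_def mult.commute)
  also have "\<dots> = (\<Sum>s<j. \<Sum>t\<in>{s * i..<s * i + i}. x ^ t)" by (rule sum.nat_group[symmetric])
  also have "\<dots> = (\<Sum>s<j. x ^ (s * i) * pow_sum i x)"
  proof (rule sum.cong)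
    fix s
    have "(\<Sum>t\<in>{s * i..<s * i + i}. x ^ t) = (\<Sum>t<i. x ^ (t + s * i))"
      using sum.shift_bounds_nat_ivl[of "\<lambda>t. x ^ t" 0 "s * i" i]
      by (simp add: add.commute atLeast0LessThan)
    then show "(\<Sum>t\<in>{s * i..<s * i + i}. x ^ t) = x ^ (s * i) * pow_sum i x"
      by (simp add: pow_sum_def power_add sum_distrib_right mult.commute)
  qed simp
  finally show ?thesis
    by (simp add: pow_sum_def sum_distrib_left mult_ac power_mult[symmetric])
qed

lemma pow_sum_one [simp]: "pow_sum n 1 = of_nat n"
  by (simp add: pow_sum_def)

lemma poly_pow_sum: "poly (pow_sum n p) x = pow_sum n (poly p x)"
  by (simp add: pow_sum_def poly_sum)

abbreviation pX :: "int poly" where "pX \<equiv> [:0, 1:]"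

text \<open>
  Write \<open>S\<^sub>i\<close> for \<open>pow_sum i X\<close> and \<open>N\<close> for \<open>S\<^sub>n\<close>. If \<open>i j\<close> is one modulo \<open>n\<close>, then
  \<open>S\<^sub>i(X) S\<^sub>j(X^i) = S\<^sub>i\<^sub>j(X)\<close> is one modulo \<open>N\<close>. By Euler's theorem suitable multiples of \<open>N\<close> correct
  the \<open>k\<close>-th powers of the two factors to polynomials \<open>u\<close> and \<open>v\<close> with value one at \<open>1\<close>. Then \<open>u v - 1\<close>
  is divisible by \<open>N\<close> and vanishes at \<open>1\<close>, so it is divisible by \<open>(X - 1) N = X^n - 1\<close>. The value of
  \<open>u\<close> at an element of order \<open>n\<close> is a Bass cyclic unit.
\<close>

lemma bass_unit_polynomial:
  assumes n: "n \<ge> 2" and i: "coprime i n"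
  obtains k a v where "k \<ge> 1"
    and "poly (pow_sum i pX ^ k - [:a:] * pow_sum n pX) 1 = 1"
    and "poly v 1 = 1"
    and "pX ^ n - 1 dvd (pow_sum i pX ^ k - [:a:] * pow_sum n pX) * v - 1"
proof -
  obtain j where "[i * j = Suc 0] (mod n)"
    using cong_solve_coprime_nat[OF i] by blast
  then have "(i * j) mod n = 1" using n by (simp add: cong_def)
  then obtain m where m: "i * j = 1 + n * m"
    by (metis add.commute mult_div_mod_eq)
  have j: "coprime j n"
    using m by (metis coprime_mult_left_iff gcd_add_mult coprime_iff_gcd_eq_1 gcd.commute gcd_1_nat mult.commute add.commute)
  define k where "k = totient n"
  have k: "k \<ge> 1" using n by (simp add: k_def Suc_le_eq)
  have "\<exists>a. int h ^ k - a * int n = 1" if "coprime h n" for h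
  proof -
    have "[h ^ k = 1] (mod n)" using euler_theorem[OF that] by (simp add: k_def)
    then have "[int h ^ k = 1] (mod int n)"
      by (metis cong_int_iff of_nat_1 of_nat_power)
    then have "int n dvd int h ^ k - 1" by (simp add: cong_iff_dvd_diff)
    then show ?thesis by (auto simp: dvd_def algebra_simps)
  qed
  from this[OF i] this[OF j] obtain a b
    where a: "int i ^ k - a * int n = 1" and b: "int j ^ k - b * int n = 1" by blast
  define N where "N = pow_sum n pX"
  define u where "u = pow_sum i pX ^ k - [:a:] * N"
  define v where "v = pow_sum j (pX ^ i) ^ k - [:b:] * N"
  have u1: "poly u 1 = 1" and v1: "poly v 1 = 1"
    using a b by (simp_all add: u_def v_def N_def poly_pow_sum)
  have "pow_sum i pX * pow_sum j (pX ^ i) = 1 + pX * pow_sum (n * m) pX"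
    unfolding pow_sum_mult m
    by (simp add: pow_sum_def sum.lessThan_Suc_shift sum_distrib_left del: sum.lessThan_Suc)
  also have "pow_sum (n * m) pX = N * pow_sum m (pX ^ n)"
    by (simp add: N_def pow_sum_mult)
  finally have "pow_sum i pX * pow_sum j (pX ^ i) - 1 = N * (pX * pow_sum m (pX ^ n))"
    by (simp only: add_diff_cancel_left' mult.left_commute)
  then have "N dvd pow_sum i pX * pow_sum j (pX ^ i) - 1" by (rule dvdI)
  also have "\<dots> dvd (pow_sum i pX * pow_sum j (pX ^ i)) ^ k - 1"
    by (simp add: power_diff_1_eq)
  finally have "N dvd (pow_sum i pX * pow_sum j (pX ^ i)) ^ k - 1" .
  moreover have "u * v - 1 = ((pow_sum i pX * pow_sum j (pX ^ i)) ^ k - 1)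
      - N * ([:b:] * pow_sum i pX ^ k + [:a:] * pow_sum j (pX ^ i) ^ k - [:a:] * [:b:] * N)"
    unfolding u_def v_def by (simp add: algebra_simps power_mult_distrib)
  ultimately have "N dvd u * v - 1" by (metis dvd_diff dvd_triv_left)
  then obtain g where g: "u * v - 1 = N * g" by (auto simp: dvd_def)
  \<comment> \<open>As \<open>N\<close> takes the nonzero value \<open>n\<close> at \<open>1\<close>, the cofactor \<open>g\<close> vanishes there.\<close>
  have "poly (N * g) 1 = 0" unfolding g[symmetric] by (simp add: u1 v1)
  then have "poly g 1 = 0" using n by (simp add: N_def poly_pow_sum)
  then have "pX - 1 dvd g" by (simp add: poly_eq_0_iff_dvd one_pCons)
  then have "(pX - 1) * N dvd u * v - 1" unfolding g by (simp add: mult.commute mult_dvd_mono)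
  then have "pX ^ n - 1 dvd u * v - 1" unfolding N_def pow_sum_telescope .
  with that[OF k] u1 v1 show ?thesis unfolding u_def N_def by blast
qed

text \<open>
  Evaluation of an integer polynomial at a group element, by Horner's rule.
\<close>

definition poly_to_group_ring :: "('a, 'b) monoid_scheme \<Rightarrow> 'a \<Rightarrow> int poly \<Rightarrow> ('a \<Rightarrow>\<^sub>0 int)" where
  "poly_to_group_ring G x p =
     fold_coeffs (\<lambda>c a. frag_cmul c (frag_of \<one>\<^bsub>G\<^esub>) + frag_of x \<otimes>\<^bsub>group_ring G\<^esub> a) p 0"

context group
begin

interpretation ZG: ring "group_ring G"
  by (rule ring_group_ring) (rule monoid_axioms)

lemma poly_to_group_ring_0 [simp]: "poly_to_group_ring G x 0 = 0"
  by (simp add: poly_to_group_ring_def)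

lemma poly_to_group_ring_pCons [simp]:
  "poly_to_group_ring G x (pCons c p) = frag_cmul c (frag_of \<one>) + frag_of x \<star> poly_to_group_ring G x p"
  by (cases "c = 0 \<and> p = 0") (auto simp: poly_to_group_ring_def)

lemma poly_to_group_ring_closed [simp, intro]:
  "x \<in> carrier G \<Longrightarrow> poly_to_group_ring G x p \<in> carrier (group_ring G)"
  by (induction p) auto

lemma poly_to_group_ring_add:
  "poly_to_group_ring G x (p + q) = poly_to_group_ring G x p + poly_to_group_ring G x q"
  by (induction p q rule: poly_induct2)
     (simp_all add: frag_cmul_distrib group_ring_mult_add algebra_simps)

lemma poly_to_group_ring_smult:
  "poly_to_group_ring G x (Polynomial.smult c p) = frag_cmul c (poly_to_group_ring G x p)"
  by (induction p) (simp_all add: frag_cmul_distrib2 frag_cmul_mult)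

lemma poly_to_group_ring_mult:
  assumes "x \<in> carrier G"
  shows "poly_to_group_ring G x (p * q) = poly_to_group_ring G x p \<star> poly_to_group_ring G x q"
  using assms by (induction p)
    (simp_all add: poly_to_group_ring_add poly_to_group_ring_smult group_ring_mult_add
      frag_cmul_mult ZG.m_assoc)

lemma poly_to_group_ring_1 [simp]: "x \<in> carrier G \<Longrightarrow> poly_to_group_ring G x 1 = frag_of \<one>"
  by (simp add: one_pCons)

lemma poly_to_group_ring_power:
  assumes "x \<in> carrier G"
  shows "poly_to_group_ring G x (p ^ k) = poly_to_group_ring G x p ^^^ k"
proof (induction k)
  case (Suc k)
  have "p ^ Suc k = p ^ k * p" by simp
  then show ?case using Suc assms by (simp only: poly_to_group_ring_mult ZG.nat_pow_Suc)
qed (use assms in \<open>simp add: group_ring_one_eq\<close>)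

lemma augmentation_poly_to_group_ring:
  "augmentation (poly_to_group_ring G x p) = poly p 1"
proof (induction p)
  case (pCons c p)
  then show ?case by (simp add: augmentation_add augmentation_mult augmentation_cmul)
qed simp

lemma poly_to_group_ring_eq_one:
  assumes x: "x \<in> carrier G" and dvd: "pX ^ ord x - 1 dvd p - 1"
  shows "poly_to_group_ring G x p = frag_of \<one>"
proof -
  from dvd obtain g where "p - 1 = (pX ^ ord x - 1) * g" by (auto simp: dvd_def)
  then have "p = 1 + (pX ^ ord x + Polynomial.smult (-1) 1) * g" by (simp add: algebra_simps)
  moreover have "poly_to_group_ring G x (pX ^ ord x + Polynomial.smult (-1) 1) = 0"
    unfolding poly_to_group_ring_add poly_to_group_ring_power[OF x] poly_to_group_ring_smult
    using x by (simp add: gpow_frag_of)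
  ultimately show ?thesis
    using x by (simp add: poly_to_group_ring_add poly_to_group_ring_mult)
qed

text \<open>
  The additive extension of the character \<open>x^t \<mapsto> \<zeta>^t\<close> of the cyclic group generated by \<open>x\<close>, where \<open>\<zeta>\<close> is
  a primitive root of unity of order \<open>ord x\<close>. Coefficients outside this cyclic group are ignored.
\<close>

definition cyclic_character :: "'a \<Rightarrow> ('a \<Rightarrow>\<^sub>0 int) \<Rightarrow> complex" where
  "cyclic_character x a =
     (\<Sum>t\<in>{..<ord x}. of_int (Poly_Mapping.lookup a (x [^] t)) * cis (2 * pi / ord x) ^ t)"

lemma cyclic_character_add:
  "cyclic_character x (a + b) = cyclic_character x a + cyclic_character x b"
  by (simp add: cyclic_character_def lookup_add sum.distrib ring_distribs)

lemma cyclic_character_cmul: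
  "cyclic_character x (frag_cmul c a) = of_int c * cyclic_character x a"
  by (simp add: cyclic_character_def sum_distrib_left mult_ac)

lemma cis_root_power: "n > 0 \<Longrightarrow> cis (2 * pi / real n) ^ n = 1"
  by (simp add: DeMoivre)

lemma cyclic_character_pow:
  assumes fin: "finite (carrier G)" and x: "x \<in> carrier G"
  shows "cyclic_character x (frag_of (x [^] s)) = cis (2 * pi / ord x) ^ s"
proof -
  define n where "n = ord x"
  have n: "n > 0" unfolding n_def using ord_ge_1[OF fin x] by simp
  have "x [^] t = x [^] s \<longleftrightarrow> t = s mod n" if "t < n" for t
  proof -
    have "x [^] s = x [^] (s mod n)"
      using x by (intro nat_pow_mod) (simp_all add: n_def)
    moreover have "s mod n \<le> n - 1" "t \<le> n - 1"
      using that n by (simp_all add: less_Suc_eq_le[symmetric])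
    then have "x [^] t = x [^] (s mod n) \<Longrightarrow> t = s mod n"
      using ord_inj[OF x] by (auto simp: inj_on_def n_def)
    ultimately show ?thesis by auto
  qed
  then have "cyclic_character x (frag_of (x [^] s)) =
      (\<Sum>t<n. if t = s mod n then cis (2 * pi / n) ^ t else 0)"
    unfolding cyclic_character_def n_def[symmetric] by (intro sum.cong) auto
  also have "\<dots> = cis (2 * pi / n) ^ (s mod n)" using n by simp
  also have "\<dots> = cis (2 * pi / n) ^ (s mod n + n * (s div n))"
    unfolding power_add power_mult cis_root_power[OF n] by simp
  finally show ?thesis by (simp add: n_def)
qed

lemma cyclic_character_poly:
  assumes fin: "finite (carrier G)" and x: "x \<in> carrier G"
  shows "cyclic_character x (poly_to_group_ring G x p) =
    poly (map_poly of_int p) (cis (2 * pi / ord x))"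
proof -
  \<comment> \<open>Horner's rule multiplies by \<open>x\<close> in each step, so the induction carries a power of \<open>x\<close> along.\<close>
  have "cyclic_character x (frag_of (x [^] s) \<star> poly_to_group_ring G x p) =
      cis (2 * pi / ord x) ^ s * poly (map_poly of_int p) (cis (2 * pi / ord x))" for s :: nat
  proof (induction p arbitrary: s)
    case 0
    show ?case by (simp add: cyclic_character_def)
  next
    case (pCons c p)
    have "frag_of (x [^] s) \<star> poly_to_group_ring G x (pCons c p) =
       frag_cmul c (frag_of (x [^] s)) + frag_of (x [^] Suc s) \<star> poly_to_group_ring G x p"
      using x by (simp add: group_ring_mult_add frag_cmul_mult ZG.m_assoc[symmetric])
    then show ?case
      using pCons.IH[of "Suc s"]
      by (simp add: cyclic_character_add cyclic_character_cmul cyclic_character_pow[OF fin x]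
        map_poly_pCons algebra_simps del: poly_to_group_ring_pCons)
  qed
  from this[of 0] show ?thesis using x by simp
qed

lemma map_poly_of_int_add:
  "map_poly of_int (p + q) = map_poly of_int p + (map_poly of_int q :: complex poly)"
  by (rule poly_eqI) (simp add: coeff_map_poly)

lemma map_poly_of_int_mult:
  "map_poly of_int (p * q) = map_poly of_int p * (map_poly of_int q :: complex poly)"
  by (rule poly_eqI) (simp add: coeff_map_poly coeff_mult)

text \<open>
  At a primitive \<open>n\<close>-th root of unity \<open>\<zeta>\<close> the Bass unit belonging to \<open>i\<close> has the value
  \<open>((\<zeta>^i - 1) / (\<zeta> - 1))^k\<close>. If the unit has finite order, then \<open>|\<zeta>^i - 1| = |\<zeta> - 1|\<close>. But along the
  upper half circle the distance from \<open>1\<close> is strictly increasing, so this is impossible for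
  \<open>1 < i \<le> n / 2\<close>.
\<close>

lemma coprime_bound_of_units_torsion:
  assumes fin: "finite (carrier G)" and x: "x \<in> carrier G"
    and tors: "m \<ge> 1" "\<forall>u\<in>normalized_units G. u ^^^ m = frag_of \<one>"
    and i: "coprime i (ord x)" "i > 1"
  shows "2 * i > ord x"
proof (rule ccontr)
  define n where "n = ord x"
  assume "\<not> 2 * i > ord x"
  then have in2: "2 * i \<le> n" by (simp add: n_def)
  then have n: "n \<ge> 2" using i by simp
  define \<zeta> where "\<zeta> = cis (2 * pi / n)"
  define E :: "int poly \<Rightarrow> complex" where "E = (\<lambda>p. poly (map_poly of_int p) \<zeta>)"
  have E_mult: "E (p * q) = E p * E q" for p q by (simp add: E_def map_poly_of_int_mult)
  have E_1: "E 1 = 1" by (simp add: E_def)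
  have E_power: "E (p ^ k) = E p ^ k" for p k by (induction k) (simp_all add: E_mult E_1)
  have E_add: "E (p + q) = E p + E q" for p q by (simp add: E_def map_poly_of_int_add)
  have E_diff: "E (p - q) = E p - E q" for p q using E_add[of "p - q" q] by simp
  have E_X: "E pX = \<zeta>" by (simp add: E_def map_poly_pCons)
  have E_0: "E 0 = 0" by (simp add: E_def)
  have E_sum: "E (pow_sum k pX) = pow_sum k \<zeta>" for k
    by (induction k) (simp_all add: pow_sum_def E_0 E_add E_power E_X)
  obtain k a v where k: "k \<ge> 1" and u1: "poly (pow_sum i pX ^ k - [:a:] * pow_sum n pX) 1 = 1"
    and v1: "poly v 1 = 1"
    and uv: "pX ^ n - 1 dvd (pow_sum i pX ^ k - [:a:] * pow_sum n pX) * v - 1"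
    using bass_unit_polynomial[OF n, of i] i by (auto simp: n_def)
  define u where "u = pow_sum i pX ^ k - [:a:] * pow_sum n pX"
  have "poly_to_group_ring G x u \<star> poly_to_group_ring G x v = frag_of \<one>"
    "poly_to_group_ring G x v \<star> poly_to_group_ring G x u = frag_of \<one>"
    using poly_to_group_ring_eq_one[OF x uv[unfolded n_def]] x
    by (simp_all add: poly_to_group_ring_mult[symmetric] u_def n_def mult.commute)
  moreover have "augmentation (poly_to_group_ring G x u) = 1"
    using u1 by (simp only: augmentation_poly_to_group_ring u_def)
  moreover have "Poly_Mapping.keys (poly_to_group_ring G x p) \<subseteq> carrier G" for p
    using poly_to_group_ring_closed[OF x] by (simp add: group_ring_carrier_iff)
  ultimately have "poly_to_group_ring G x u \<in> normalized_units G"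
    unfolding normalized_units_def units_group_ring_iff[OF monoid_axioms] by blast
  then have "poly_to_group_ring G x (u ^ m) = frag_of (x [^] (0::nat))"
    using tors x by (simp add: poly_to_group_ring_power)
  then have "E (u ^ m) = 1"
    using cyclic_character_poly[OF fin x, of "u ^ m"] cyclic_character_pow[OF fin x, of 0]
    by (simp add: E_def \<zeta>_def n_def)
  then have "norm (E u) ^ m = 1" by (simp add: E_power flip: norm_power)
  then have "norm (E u) = 1" using tors(1) power_eq_imp_eq_base[of "norm (E u)" m 1] by simp
  have \<zeta>n: "\<zeta> ^ n = 1" unfolding \<zeta>_def using n by (simp add: cis_root_power)
  have re: "Re (\<zeta> ^ t) = cos (2 * pi * t / n)" for t
    by (simp add: \<zeta>_def DeMoivre mult_ac)
  have norm2: "(norm (\<zeta> ^ t - 1))\<^sup>2 = 2 - 2 * cos (2 * pi * t / n)" for t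
  proof -
    have "norm (\<zeta> ^ t) = 1" by (simp add: \<zeta>_def norm_power)
    then have "(Re (\<zeta> ^ t))\<^sup>2 + (Im (\<zeta> ^ t))\<^sup>2 = 1" by (simp add: cmod_def)
    then show ?thesis
      unfolding cmod_power2 by (simp add: re power2_eq_square algebra_simps)
  qed
  have lt: "cos (2 * pi * i / n) < cos (2 * pi * 1 / n)"
    by (rule cos_monotone_0_pi) (use i in2 n in \<open>auto simp: field_simps simp flip: of_nat_mult\<close>)
  have "\<zeta> \<noteq> 1"
  proof
    assume "\<zeta> = 1"
    then have "cos (2 * pi * 1 / n) = cos (2 * pi * i / n)" using re[of 1] re[of i] by simp
    with lt show False by simp
  qed
  then have "pow_sum n \<zeta> = 0"
    using pow_sum_telescope[of \<zeta> n] by (simp add: \<zeta>n)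
  then have "E u = pow_sum i \<zeta> ^ k" by (simp only: u_def E_diff E_mult E_power E_sum) simp
  then have "norm (pow_sum i \<zeta>) = 1"
    using \<open>norm (E u) = 1\<close> k power_eq_imp_eq_base[of "norm (pow_sum i \<zeta>)" k 1]
    by (simp add: norm_power)
  then have "norm (\<zeta> - 1) = norm (\<zeta> ^ i - 1)"
    unfolding pow_sum_telescope[symmetric] by (simp add: norm_mult)
  then show False using norm2[of 1] norm2[of i] lt by simp
qed

end

section \<open>Groups with normal cyclic subgroups and few element orders\<close>

text \<open>
  The defining relations of the quaternion group for \<open>a = i\<close> and \<open>b = j\<close>, with \<open>a\<^sup>2\<close> in the role of \<open>-1\<close>.
  As \<open>-1\<close> lies in every nontrivial normal subgroup of \<^const>\<open>K8\<close>, the condition \<open>a\<^sup>2 \<noteq> 1\<close> excludes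
  proper quotients.
\<close>

definition quaternion_pair :: "('a, 'b) monoid_scheme \<Rightarrow> 'a \<Rightarrow> 'a \<Rightarrow> bool" where
  "quaternion_pair G a b \<longleftrightarrow> a \<in> carrier G \<and> b \<in> carrier G \<and>
     b \<otimes>\<^bsub>G\<^esub> b = a \<otimes>\<^bsub>G\<^esub> a \<and> (a \<otimes>\<^bsub>G\<^esub> a) \<otimes>\<^bsub>G\<^esub> (a \<otimes>\<^bsub>G\<^esub> a) = \<one>\<^bsub>G\<^esub> \<and>
     a \<otimes>\<^bsub>G\<^esub> a \<noteq> \<one>\<^bsub>G\<^esub> \<and> b \<otimes>\<^bsub>G\<^esub> a = (a \<otimes>\<^bsub>G\<^esub> a) \<otimes>\<^bsub>G\<^esub> (a \<otimes>\<^bsub>G\<^esub> b)"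

text \<open>
  The first assumption says that every cyclic subgroup is normal, the second lists the element orders
  that survive the test by Bass units. A direct analysis of these few orders takes the place of the
  general classification of Hamiltonian groups.
\<close>

locale hamiltonian_small_orders = group +
  assumes conj: "\<And>x y. x \<in> carrier G \<Longrightarrow> y \<in> carrier G \<Longrightarrow> \<exists>k::nat. x \<otimes> y = y \<otimes> x [^] k"
    and ord_cases: "\<And>x. x \<in> carrier G \<Longrightarrow> ord x \<in> {1, 2, 3, 4, 6}"
    and nonabelian: "\<exists>x\<in>carrier G. \<exists>y\<in>carrier G. x \<otimes> y \<noteq> y \<otimes> x"
begin

lemma pow_ord: "x \<in> carrier G \<Longrightarrow> ord x dvd n \<Longrightarrow> x [^] n = \<one>"
  by (simp add: pow_eq_id)

text \<open>
  A normal subgroup with at most two elements is central.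
\<close>

lemma square_one_central:
  assumes x: "x \<in> carrier G" "x \<otimes> x = \<one>" and y: "y \<in> carrier G"
  shows "x \<otimes> y = y \<otimes> x"
proof -
  obtain k :: nat where k: "x \<otimes> y = y \<otimes> x [^] k" using conj x y by blast
  have "x [^] k = x [^] (k mod 2)" using x by (intro nat_pow_mod) (simp_all add: numeral_2_eq_2)
  moreover have "k mod 2 = 0 \<or> k mod 2 = 1" by auto
  ultimately have "x [^] k = \<one> \<or> x [^] k = x" using x by auto
  then show ?thesis
  proof
    assume "x [^] k = \<one>"
    then have "x = \<one>" using k x y by (metis r_one r_cancel_one')
    then show ?thesis using y by simp
  qed (use k in simp)
qed

text \<open>
  Conjugation by \<open>y\<close> fixes \<open>x\<close> or inverts it. If it inverts \<open>x\<close>, normality of the subgroup generated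
  by \<open>y\<close> gives \<open>y^l x = y\<close> for some \<open>l\<close>; so \<open>x\<close> is a power of \<open>y\<close> and commutes with \<open>y\<close> after all.
\<close>

lemma cube_one_central:
  assumes x: "x \<in> carrier G" "x [^] (3::nat) = \<one>" and y: "y \<in> carrier G"
  shows "x \<otimes> y = y \<otimes> x"
proof -
  obtain k :: nat where k: "x \<otimes> y = y \<otimes> x [^] k" using conj x y by blast
  have "x [^] k = x [^] (k mod 3)" using x by (intro nat_pow_mod)
  moreover have "k mod 3 = 0 \<or> k mod 3 = 1 \<or> k mod 3 = 2" by auto
  ultimately have "x [^] k = \<one> \<or> x [^] k = x \<or> x [^] k = x \<otimes> x"
    using x by (auto simp: numeral_2_eq_2)
  then consider "x [^] k = \<one>" | "x [^] k = x" | "x [^] k = x \<otimes> x" by blast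
  then show ?thesis
  proof cases
    case 1
    then have "x = \<one>" using k x y by (metis r_one r_cancel_one')
    then show ?thesis using y by simp
  next
    case 2
    then show ?thesis using k by simp
  next
    case 3
    obtain l :: nat where l: "y \<otimes> x = x \<otimes> y [^] l" using conj x y by blast
    have "x \<otimes> y = (y \<otimes> x) \<otimes> x" using k x y by (simp add: 3 m_assoc)
    then have "x \<otimes> y = x \<otimes> (y [^] l \<otimes> x)" using l x y by (simp add: m_assoc)
    then have yl: "y [^] l \<otimes> x = y" using x y by simp
    have "y [^] l \<otimes> (x \<otimes> y) = y \<otimes> y" using yl x y by (simp add: m_assoc[symmetric])
    moreover have "y [^] l \<otimes> (y \<otimes> x) = y \<otimes> y"
    proof -
      have "y [^] l \<otimes> (y \<otimes> x) = (y [^] l \<otimes> y) \<otimes> x" using x y by (simp add: m_assoc)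
      also have "y [^] l \<otimes> y = y \<otimes> y [^] l" using y by (metis nat_pow_Suc nat_pow_Suc2)
      finally show ?thesis using yl x y by (simp add: m_assoc)
    qed
    ultimately show ?thesis using x y l_cancel[of "y [^] l" "x \<otimes> y" "y \<otimes> x"] by simp
  qed
qed

text \<open>
  An element of order six is the product of its third and fourth powers, which are central by the
  two preceding lemmas. So only the order four is left.
\<close>

lemma noncommuting_order_4:
  assumes x: "x \<in> carrier G" and y: "y \<in> carrier G" and xy: "x \<otimes> y \<noteq> y \<otimes> x"
  shows "x [^] (4::nat) = \<one>" "x \<otimes> x \<noteq> \<one>"
proof -
  show sq: "x \<otimes> x \<noteq> \<one>" using square_one_central x y xy by blast
  have "ord x \<noteq> 6"
  proof
    assume o: "ord x = 6"
    have p: "x [^] (6::nat) = \<one>" "x [^] (12::nat) = \<one>" using o x by (auto intro!: pow_ord)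
    have 3: "x [^] (3::nat) \<otimes> y = y \<otimes> x [^] (3::nat)"
      using x y p by (intro square_one_central) (simp_all add: nat_pow_mult)
    have 4: "x [^] (4::nat) \<otimes> y = y \<otimes> x [^] (4::nat)"
      using x y p by (intro cube_one_central) (simp_all add: nat_pow_pow)
    have "x [^] (7::nat) = x [^] (7 mod 6 :: nat)" using nat_pow_mod[OF x p(1), of 7] .
    then have "x = x [^] (3::nat) \<otimes> x [^] (4::nat)" using x by (simp add: nat_pow_mult)
    then have "x \<otimes> y = y \<otimes> x" using x y 3 4 by (metis m_assoc nat_pow_closed)
    with xy show False ..
  qed
  moreover have "ord x \<noteq> 1" using xy x y by (metis ord_eq_1 l_one r_one)
  moreover have "ord x \<noteq> 2"
    using sq pow_ord[OF x, of 2] x by (auto simp: numeral_2_eq_2)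
  moreover have "ord x \<noteq> 3"
    using cube_one_central[OF x _ y] xy pow_ord_eq_1[OF x] by auto
  ultimately have "ord x = 4" using ord_cases[OF x] by auto
  then show "x [^] (4::nat) = \<one>" using pow_ord_eq_1[OF x] by simp
qed

text \<open>
  If \<open>s\<close> has order three and \<open>a\<close> is a noncentral element, then \<open>s\<close> is central and \<open>a\<close> has order four, so
  \<open>a s\<close> has the forbidden order twelve. This excludes the orders three and six.
\<close>

lemma pow_4:
  assumes t: "t \<in> carrier G"
  shows "t [^] (4::nat) = \<one>"
proof (rule ccontr)
  assume t4: "t [^] (4::nat) \<noteq> \<one>"
  obtain a b where a: "a \<in> carrier G" and b: "b \<in> carrier G" and ab: "a \<otimes> b \<noteq> b \<otimes> a"
    using nonabelian by blast
  note a4 = noncommuting_order_4[OF a b ab]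
  define s where "s = t \<otimes> t"
  have s: "s \<in> carrier G" using t by (simp add: s_def)
  have s_pow: "s [^] n = t [^] (2 * n)" for n :: nat
    using t nat_pow_pow[OF t, of 2 n] by (simp add: s_def numeral_2_eq_2)
  have "ord t = 3 \<or> ord t = 6" using ord_cases[OF t] t4 pow_ord[OF t, of 4] by auto
  then have s3: "s [^] (3::nat) = \<one>" unfolding s_pow using t by (auto intro!: pow_ord)
  have s1: "s \<noteq> \<one>"
  proof
    assume "s = \<one>"
    then have "t [^] (4::nat) = \<one>" using s_pow[of 2] by simp
    with t4 show False ..
  qed
  have as: "a \<otimes> s = s \<otimes> a" using cube_one_central[OF s s3 a] by simp
  have dist: "(a \<otimes> s) [^] n = a [^] n \<otimes> s [^] n" for n :: nat
    using pow_mult_distrib[OF as a s] .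
  have asc: "a \<otimes> s \<in> carrier G" using a s by simp
  have "(a \<otimes> s) [^] (4::nat) = \<one> \<or> (a \<otimes> s) [^] (6::nat) = \<one>"
    using ord_cases[OF asc] pow_ord[OF asc, of 4] pow_ord[OF asc, of 6] by auto
  moreover have "(a \<otimes> s) [^] (4::nat) = s"
    using nat_pow_mod[OF s s3, of 4] a s a4 by (simp add: dist)
  moreover have "(a \<otimes> s) [^] (6::nat) = a \<otimes> a"
    using nat_pow_mod[OF s s3, of 6] nat_pow_mod[OF a a4(1), of 6] a s
    by (simp add: dist) (simp add: numeral_2_eq_2)
  ultimately show False using s1 a4 by simp
qed

lemma sq_central:
  assumes "x \<in> carrier G" "y \<in> carrier G"
  shows "(x \<otimes> x) \<otimes> y = y \<otimes> (x \<otimes> x)" "(x \<otimes> x) \<otimes> (x \<otimes> x) = \<one>"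
proof -
  have "x [^] (4::nat) = (x \<otimes> x) \<otimes> (x \<otimes> x)"
    using assms by (simp add: numeral_eq_Suc m_assoc)
  then show *: "(x \<otimes> x) \<otimes> (x \<otimes> x) = \<one>" using pow_4[OF assms(1)] by simp
  show "(x \<otimes> x) \<otimes> y = y \<otimes> (x \<otimes> x)" using assms * by (intro square_one_central) auto
qed

text \<open>
  Conjugation by \<open>y\<close> takes \<open>x\<close> to a power of \<open>x\<close>. The powers \<open>1\<close> and \<open>x\<^sup>2\<close> are central, and \<open>x\<close> itself is
  excluded, so the power is \<open>x\<^sup>3 = x\<^sup>2 x\<close>.
\<close>

lemma noncommuting_swap:
  assumes x: "x \<in> carrier G" and y: "y \<in> carrier G" and xy: "x \<otimes> y \<noteq> y \<otimes> x"
  shows "x \<otimes> y = (x \<otimes> x) \<otimes> (y \<otimes> x)"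
proof -
  obtain k :: nat where k: "x \<otimes> y = y \<otimes> x [^] k" using conj x y by blast
  have k4: "x [^] k = x [^] (k mod 4)" by (rule nat_pow_mod[OF x pow_4[OF x]])
  have pows: "x [^] (0::nat) = \<one>" "x [^] (1::nat) = x" "x [^] (2::nat) = x \<otimes> x"
    "x [^] (3::nat) = x \<otimes> x \<otimes> x"
    using x by (simp_all add: numeral_2_eq_2 numeral_3_eq_3)
  have "k mod 4 = 0 \<or> k mod 4 = 1 \<or> k mod 4 = 2 \<or> k mod 4 = 3" by linarith
  then consider "x [^] k = \<one>" | "x [^] k = x" | "x [^] k = x \<otimes> x" | "x [^] k = x \<otimes> x \<otimes> x"
    unfolding k4 using pows by metis
  then show ?thesis
  proof cases
    case 1
    then have "x = \<one>" using k x y by (metis r_one r_cancel_one')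
    then show ?thesis using xy y by simp
  next
    case 2
    then show ?thesis using k xy by simp
  next
    case 3
    have "x \<otimes> y = (x \<otimes> x) \<otimes> y" unfolding k 3 by (rule sq_central(1)[OF x y, symmetric])
    then have "x = x \<otimes> x" using x y r_cancel[of y x "x \<otimes> x"] by simp
    then have "x = \<one>" using x by simp
    then show ?thesis using xy y by simp
  next
    case 4
    then have "x \<otimes> y = (y \<otimes> (x \<otimes> x)) \<otimes> x" using k x y by (simp add: m_assoc)
    also have "y \<otimes> (x \<otimes> x) = (x \<otimes> x) \<otimes> y" using sq_central(1)[OF x y] by simp
    finally show ?thesis using x y by (simp add: m_assoc)
  qed
qed

text \<open>
  Each of the two elements inverts the other; exchanging the factors of \<open>x y\<close> twice produces the factor
  \<open>x\<^sup>2 y\<^sup>2\<close>, which is therefore \<open>1\<close>.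
\<close>

lemma noncommuting_squares:
  assumes x: "x \<in> carrier G" and y: "y \<in> carrier G" and xy: "x \<otimes> y \<noteq> y \<otimes> x"
  shows "x \<otimes> x = y \<otimes> y"
proof -
  have "x \<otimes> y = (x \<otimes> x) \<otimes> (y \<otimes> x)" by (rule noncommuting_swap[OF assms])
  also have "y \<otimes> x = (y \<otimes> y) \<otimes> (x \<otimes> y)"
    by (rule noncommuting_swap[OF y x]) (use xy in auto)
  also have "(x \<otimes> x) \<otimes> ((y \<otimes> y) \<otimes> (x \<otimes> y)) = ((x \<otimes> x) \<otimes> (y \<otimes> y)) \<otimes> (x \<otimes> y)"
    using x y by (simp only: m_assoc m_closed)
  finally have "\<one> \<otimes> (x \<otimes> y) = ((x \<otimes> x) \<otimes> (y \<otimes> y)) \<otimes> (x \<otimes> y)"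
    using x y by simp
  then have "(x \<otimes> x) \<otimes> (y \<otimes> y) = \<one>"
    using x y r_cancel[of "x \<otimes> y" \<one> "(x \<otimes> x) \<otimes> (y \<otimes> y)"] by simp
  then show ?thesis
    using sq_central(2)[OF x y] x y l_cancel[of "x \<otimes> x" "x \<otimes> x" "y \<otimes> y"] by simp
qed

text \<open>
  Let \<open>a\<close> and \<open>b\<close> be noncommuting and \<open>z = a\<^sup>2 = b\<^sup>2\<close>. Every \<open>g\<close> commutes with \<open>a\<close> up to a factor \<open>1\<close> or
  \<open>z\<close>, and likewise with \<open>b\<close>. All four combinations of factors occur among \<open>1, b, a, a b\<close>, so after
  division by one of these there remains an element \<open>c\<close> commuting with both \<open>a\<close> and \<open>b\<close>. Then \<open>a c\<close>
  does not commute with \<open>b\<close>; so \<open>(a c)\<^sup>2 = b\<^sup>2 = a\<^sup>2\<close> and \<open>c\<^sup>2 = 1\<close>.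
\<close>

lemma quaternion_decomposition:
  obtains a b where "quaternion_pair G a b"
    and "\<And>g. g \<in> carrier G \<Longrightarrow>
      \<exists>q\<in>{\<one>, a, b, a \<otimes> b}. \<exists>c\<in>carrier G. c \<otimes> c = \<one> \<and> g = q \<otimes> c"
proof -
  obtain a b where a: "a \<in> carrier G" and b: "b \<in> carrier G" and ab: "a \<otimes> b \<noteq> b \<otimes> a"
    using nonabelian by blast
  define z where "z = a \<otimes> a"
  have z: "z \<in> carrier G" using a by (simp add: z_def)
  have bb: "b \<otimes> b = z" using noncommuting_squares[OF a b ab] by (simp add: z_def)
  have zz: "z \<otimes> z = \<one>" using sq_central(2)[OF a a] by (simp add: z_def)
  have zy: "y \<otimes> z = z \<otimes> y" if "y \<in> carrier G" for y
    using sq_central(1)[OF a that] by (simp add: z_def)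
  have ba: "b \<otimes> a = z \<otimes> (a \<otimes> b)"
    using noncommuting_swap[OF b a] ab bb by metis
  have rules: "a \<otimes> (a \<otimes> y) = z \<otimes> y" "b \<otimes> (b \<otimes> y) = z \<otimes> y"
    "b \<otimes> (a \<otimes> y) = z \<otimes> (a \<otimes> (b \<otimes> y))" "a \<otimes> (z \<otimes> y) = z \<otimes> (a \<otimes> y)"
    "b \<otimes> (z \<otimes> y) = z \<otimes> (b \<otimes> y)" "z \<otimes> (z \<otimes> y) = y" if "y \<in> carrier G" for y
    using that a b z bb ba zz zy[OF a] zy[OF b]
    by (simp_all add: m_assoc[symmetric] z_def[symmetric])
  have "quaternion_pair G a b"
    using a b bb zz ba noncommuting_order_4(2)[OF a b ab]
    by (simp add: quaternion_pair_def z_def)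
  moreover have "\<exists>q\<in>{\<one>, a, b, a \<otimes> b}. \<exists>c\<in>carrier G. c \<otimes> c = \<one> \<and> g = q \<otimes> c"
    if g: "g \<in> carrier G" for g
  proof -
    have swap: "g \<otimes> x = z \<otimes> (x \<otimes> g)" if "x \<in> {a, b}" "g \<otimes> x \<noteq> x \<otimes> g" for x
    proof -
      have x: "x \<in> carrier G" "x \<otimes> x = z" using that a b bb by (auto simp: z_def)
      then show ?thesis
        using noncommuting_swap[OF g x(1) that(2)] noncommuting_squares[OF g x(1) that(2)] by simp
    qed
    have sq: "c \<otimes> c = \<one>" if c: "c \<in> carrier G" "c \<otimes> a = a \<otimes> c" "c \<otimes> b = b \<otimes> c" for c
    proof -
      have "(a \<otimes> c) \<otimes> b = (a \<otimes> b) \<otimes> c" "b \<otimes> (a \<otimes> c) = (b \<otimes> a) \<otimes> c"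
        using a b c by (simp_all add: m_assoc)
      then have "(a \<otimes> c) \<otimes> b \<noteq> b \<otimes> (a \<otimes> c)" using ab a b c by simp
      then have "(a \<otimes> c) \<otimes> (a \<otimes> c) = z"
        using noncommuting_squares[of "a \<otimes> c" b] a b c bb by simp
      moreover have "(a \<otimes> c) \<otimes> (a \<otimes> c) = z \<otimes> (c \<otimes> c)"
        using a c by (metis m_assoc m_closed z_def)
      ultimately show ?thesis using z c l_cancel[of z "c \<otimes> c" \<one>] by simp
    qed
    have *: ?thesis if "q \<in> {\<one>, a, b, a \<otimes> b}" "c \<in> carrier G" "g = q \<otimes> c"
      "c \<otimes> a = a \<otimes> c" "c \<otimes> b = b \<otimes> c" for q c
      using that sq by blast
    consider "g \<otimes> a = a \<otimes> g" "g \<otimes> b = b \<otimes> g"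
      | "g \<otimes> a = z \<otimes> (a \<otimes> g)" "g \<otimes> b = b \<otimes> g"
      | "g \<otimes> a = a \<otimes> g" "g \<otimes> b = z \<otimes> (b \<otimes> g)"
      | "g \<otimes> a = z \<otimes> (a \<otimes> g)" "g \<otimes> b = z \<otimes> (b \<otimes> g)"
      using swap[of a] swap[of b] by fast
    then show ?thesis
    proof cases
      case 1
      then show ?thesis using *[of \<one> g] g by simp
    next
      case 2
      then show ?thesis
        using *[of b "z \<otimes> (b \<otimes> g)"] a b z g rules bb ba zz by (simp add: m_assoc)
    next
      case 3
      then show ?thesis
        using *[of a "z \<otimes> (a \<otimes> g)"] a b z g rules bb ba zz by (simp add: m_assoc)
    next
      case 4
      then show ?thesis
        using *[of "a \<otimes> b" "z \<otimes> (a \<otimes> b \<otimes> g)"] a b z g rules bb ba zz by (simp add: m_assoc)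
    qed
  qed
  ultimately show ?thesis using that by blast
qed

end

context group
begin

text \<open>
  For the eight elements of \<^const>\<open>K8\<close> the sum of the coordinates is the sign.
\<close>

definition embed_K8 :: "'a \<Rightarrow> 'a \<Rightarrow> int_quat \<Rightarrow> 'a" where
  "embed_K8 a b = (\<lambda>(p, q, r, s).
     (if p + q + r + s = 1 then \<one> else a \<otimes> a) \<otimes>
     (if q \<noteq> 0 then a else if r \<noteq> 0 then b else if s \<noteq> 0 then a \<otimes> b else \<one>))"

text \<open>
  Used from left to right, these equations bring every right-nested word in \<open>z, a, b\<close> into the form
  \<open>z^i a^j b^k\<close>.
\<close>

lemma quaternion_pair_rules:
  assumes "quaternion_pair G a b"
  defines "z \<equiv> a \<otimes> a"
  shows "a \<in> carrier G" "b \<in> carrier G" "z \<in> carrier G" "z \<noteq> \<one>"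
    "b \<otimes> b = z" "z \<otimes> z = \<one>" "b \<otimes> a = z \<otimes> (a \<otimes> b)"
    "a \<otimes> z = z \<otimes> a" "b \<otimes> z = z \<otimes> b"
    "\<And>y. y \<in> carrier G \<Longrightarrow> a \<otimes> (a \<otimes> y) = z \<otimes> y"
    "\<And>y. y \<in> carrier G \<Longrightarrow> b \<otimes> (b \<otimes> y) = z \<otimes> y"
    "\<And>y. y \<in> carrier G \<Longrightarrow> z \<otimes> (z \<otimes> y) = y"
    "\<And>y. y \<in> carrier G \<Longrightarrow> b \<otimes> (a \<otimes> y) = z \<otimes> (a \<otimes> (b \<otimes> y))"
    "\<And>y. y \<in> carrier G \<Longrightarrow> a \<otimes> (z \<otimes> y) = z \<otimes> (a \<otimes> y)"
    "\<And>y. y \<in> carrier G \<Longrightarrow> b \<otimes> (z \<otimes> y) = z \<otimes> (b \<otimes> y)"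
proof -
  show ab: "a \<in> carrier G" "b \<in> carrier G" and z: "z \<in> carrier G" and "z \<noteq> \<one>"
    and bb: "b \<otimes> b = z" and zz: "z \<otimes> z = \<one>"
    and ba: "b \<otimes> a = z \<otimes> (a \<otimes> b)"
    using assms by (auto simp: quaternion_pair_def)
  have aa: "a \<otimes> a = z" by (simp add: z_def)
  show az: "a \<otimes> z = z \<otimes> a" using ab by (simp add: z_def m_assoc)
  show bz: "b \<otimes> z = z \<otimes> b" using ab by (simp add: bb[symmetric] m_assoc)
  fix y assume y: "y \<in> carrier G"
  show "a \<otimes> (a \<otimes> y) = z \<otimes> y" "b \<otimes> (b \<otimes> y) = z \<otimes> y" "z \<otimes> (z \<otimes> y) = y"
    "b \<otimes> (a \<otimes> y) = z \<otimes> (a \<otimes> (b \<otimes> y))" "a \<otimes> (z \<otimes> y) = z \<otimes> (a \<otimes> y)"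
    "b \<otimes> (z \<otimes> y) = z \<otimes> (b \<otimes> y)"
    using ab y z aa bb zz ba az bz by (simp_all add: m_assoc[symmetric])
qed

lemma embed_K8_hom:
  assumes "quaternion_pair G a b"
  shows "embed_K8 a b \<in> hom K8 G"
proof -
  define z where "z = a \<otimes> a"
  note r = quaternion_pair_rules[OF assms, folded z_def] z_def[symmetric]
  have "\<forall>x\<in>carrier K8. embed_K8 a b x \<in> carrier G"
    by (simp add: K8_def embed_K8_def r)
  moreover have "\<forall>x\<in>carrier K8. \<forall>y\<in>carrier K8. embed_K8 a b (quat_mult x y) = embed_K8 a b x \<otimes> embed_K8 a b y"
    by (simp add: K8_def embed_K8_def m_assoc r)
  moreover have "monoid.mult K8 = quat_mult" by (simp add: K8_def)
  ultimately show ?thesis by (simp add: hom_def Pi_iff)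
qed

text \<open>
  The elements of square one form a central elementary abelian group \<open>C\<close>, which meets the quaternion
  group \<open>Q\<close> generated by \<open>a\<close> and \<open>b\<close> in \<open>{1, z}\<close>. A subgroup \<open>E\<close> of \<open>C\<close> that is maximal subject to
  \<open>z \<notin> E\<close> is a complement of \<open>{1, z}\<close> in \<open>C\<close>. So \<open>G = Q C = Q E\<close>, and the product is direct.
\<close>

lemma iso_K8_times_elementary_abelian:
  assumes fin: "finite (carrier G)" and ab: "quaternion_pair G a b"
    and central: "\<And>c g. c \<in> carrier G \<Longrightarrow> c \<otimes> c = \<one> \<Longrightarrow> g \<in> carrier G \<Longrightarrow> c \<otimes> g = g \<otimes> c"
    and decomp: "\<And>g. g \<in> carrier G \<Longrightarrow>
      \<exists>q\<in>{\<one>, a, b, a \<otimes> b}. \<exists>c\<in>carrier G. c \<otimes> c = \<one> \<and> g = q \<otimes> c"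
  shows "\<exists>E :: 'a monoid. elementary_abelian_2_group E \<and> G \<cong> K8 \<times>\<times> E"
proof -
  define z where "z = a \<otimes> a"
  note r = quaternion_pair_rules[OF ab, folded z_def] z_def[symmetric]
  define C where "C = {c \<in> carrier G. c \<otimes> c = \<one>}"
  define S where "S = {H. subgroup H G \<and> H \<subseteq> C \<and> z \<notin> H}"
  have "finite S"
    using fin by (intro finite_subset[of S "Pow (carrier G)"]) (auto simp: S_def C_def)
  moreover have "{\<one>} \<in> S" using r(4) by (auto simp: S_def C_def triv_subgroup)
  ultimately obtain E where E: "E \<in> S" and max: "\<And>H. H \<in> S \<Longrightarrow> E \<subseteq> H \<Longrightarrow> H = E"
    using finite_has_maximal[of S] by blast
  have subE: "subgroup E G" and EC: "E \<subseteq> C" and zE: "z \<notin> E" using E by (auto simp: S_def)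
  interpret E: subgroup E G by fact
  have Ecomm: "e \<otimes> g = g \<otimes> e" if "e \<in> E" "g \<in> carrier G" for e g
    using that EC central by (auto simp: C_def)
  have Esq: "e \<otimes> e = \<one>" if "e \<in> E" for e using that EC by (auto simp: C_def)
  \<comment> \<open>If neither \<open>c\<close> nor \<open>z c\<close> were in \<open>E\<close>, then \<open>E \<union> c E\<close> would be a larger subgroup without \<open>z\<close>.\<close>
  have C_cases: "c \<in> E \<or> z \<otimes> c \<in> E" if c: "c \<in> C" for c
  proof (rule ccontr)
    assume nc: "\<not> (c \<in> E \<or> z \<otimes> c \<in> E)"
    have cc: "c \<in> carrier G" "c \<otimes> c = \<one>" using c by (auto simp: C_def)
    define H where "H = E \<union> (\<lambda>e. c \<otimes> e) ` E"
    have cce: "c \<otimes> (c \<otimes> e) = e" if "e \<in> E" for e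
      using that cc by (simp add: m_assoc[symmetric])
    have comm: "e \<otimes> (c \<otimes> e') = c \<otimes> (e \<otimes> e')" if "e \<in> E" "e' \<in> E" for e e'
      using that cc Ecomm[OF that(1) cc(1)] by (simp add: m_assoc[symmetric])
    have Hc: "H \<subseteq> carrier G" using cc by (auto simp: H_def)
    have Hm: "x \<otimes> y \<in> H" if "x \<in> H" "y \<in> H" for x y
      using that cc by (auto simp: H_def m_assoc comm cce)
    have Hsq: "x \<otimes> x = \<one>" if "x \<in> H" for x
      using that cc by (auto simp: H_def m_assoc comm cce Esq)
    have "subgroup H G"
    proof (rule subgroupI)
      show "H \<noteq> {}" by (metis E.one_closed H_def UnI1 empty_iff)
      show "inv x \<in> H" if "x \<in> H" for x
        using Hsq[OF that] that Hc inv_equality[of x x] by auto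
    qed (use Hc Hm in auto)
    moreover have "z \<notin> H"
    proof
      assume "z \<in> H"
      then obtain e where e: "e \<in> E" "z = c \<otimes> e" using zE by (auto simp: H_def)
      then have "z \<otimes> c = e" using cc r Ecomm[OF e(1) cc(1)] cce[OF e(1)] by (simp add: m_assoc)
      then show False using nc e by simp
    qed
    ultimately have "H \<in> S" using Hsq Hc by (auto simp: S_def C_def)
    then have "H = E" by (rule max) (auto simp: H_def)
    moreover have "c \<in> (\<lambda>e. c \<otimes> e) ` E"
      by (rule image_eqI[of _ _ \<one>]) (use cc in auto)
    ultimately show False using nc unfolding H_def by blast
  qed
  define E' where "E' = G\<lparr>carrier := E\<rparr>"
  interpret E': group E' unfolding E'_def by (rule E.subgroup_is_group[OF group_axioms])
  have E'_simps: "carrier E' = E" "x \<otimes>\<^bsub>E'\<^esub> y = x \<otimes> y" "\<one>\<^bsub>E'\<^esub> = \<one>" for x y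
    by (simp_all add: E'_def)
  have "comm_group E'"
    by (rule E'.group_comm_groupI) (simp add: E'_simps Ecomm)
  then have el: "elementary_abelian_2_group E'"
    by (simp add: elementary_abelian_2_group_def E'_simps Esq)
  define f where "f = (\<lambda>(k, e). embed_K8 a b k \<otimes> e)"
  have emb: "embed_K8 a b k \<in> carrier G" if "k \<in> carrier K8" for k
    using embed_K8_hom[OF ab] that by (auto simp: hom_def)
  have emb_mult: "embed_K8 a b (k \<otimes>\<^bsub>K8\<^esub> l) = embed_K8 a b k \<otimes> embed_K8 a b l"
    if "k \<in> carrier K8" "l \<in> carrier K8" for k l
    using embed_K8_hom[OF ab] that by (auto simp: hom_def)
  have fhom: "f \<in> hom (K8 \<times>\<times> E') G"
  proof (rule homI)
    fix x y assume x: "x \<in> carrier (K8 \<times>\<times> E')" and y: "y \<in> carrier (K8 \<times>\<times> E')"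
    obtain k e l e' where xy: "x = (k, e)" "y = (l, e')" by fastforce
    have m: "k \<in> carrier K8" "l \<in> carrier K8" "e \<in> E" "e' \<in> E"
      using x y by (auto simp: xy E'_simps)
    have "e \<otimes> (embed_K8 a b l \<otimes> e') = embed_K8 a b l \<otimes> (e \<otimes> e')"
      using m emb Ecomm[OF m(3) emb[OF m(2)]] by (simp add: m_assoc[symmetric])
    then show "f (x \<otimes>\<^bsub>K8 \<times>\<times> E'\<^esub> y) = f x \<otimes> f y"
      using m emb by (simp add: xy f_def E'_simps emb_mult m_assoc)
  qed (auto simp: f_def E'_simps emb)
  interpret K8: group K8 by (rule group_K8)
  interpret P: group "K8 \<times>\<times> E'" by (intro DirProd_group K8.group_axioms E'.group_axioms)
  interpret f: group_hom "K8 \<times>\<times> E'" G f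
    by (intro group_hom.intro group_hom_axioms.intro P.group_axioms group_axioms fhom)
  have "inj_on f (carrier (K8 \<times>\<times> E'))"
  proof (subst f.inj_on_one_iff, intro allI impI)
    fix x assume x: "x \<in> carrier (K8 \<times>\<times> E')" "f x = \<one>"
    obtain k e where xe: "x = (k, e)" by fastforce
    have k: "k \<in> carrier K8" and e: "e \<in> E" using x by (auto simp: xe E'_simps)
    have "embed_K8 a b k \<otimes> e = \<one>" using x by (simp add: xe f_def)
    then have ke: "embed_K8 a b k = e"
      using emb[OF k] e Esq[OF e] by (metis E.mem_carrier inv_equality inv_inv)
    have "\<forall>k\<in>carrier K8. embed_K8 a b k \<otimes> embed_K8 a b k = \<one> \<longrightarrow>
        k = \<one>\<^bsub>K8\<^esub> \<or> embed_K8 a b k = z"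
      by (simp add: K8_def embed_K8_def m_assoc r)
    then have "k = \<one>\<^bsub>K8\<^esub>" using k ke e Esq[OF e] zE by metis
    moreover have "embed_K8 a b \<one>\<^bsub>K8\<^esub> = \<one>" by (simp add: K8_def embed_K8_def)
    ultimately show "x = \<one>\<^bsub>K8 \<times>\<times> E'\<^esub>" using ke by (simp add: xe E'_simps)
  qed
  moreover have "carrier G \<subseteq> f ` carrier (K8 \<times>\<times> E')"
  proof
    fix g assume g: "g \<in> carrier G"
    obtain q c where q: "q \<in> {\<one>, a, b, a \<otimes> b}" and c: "c \<in> carrier G" "c \<otimes> c = \<one>"
      and gqc: "g = q \<otimes> c"
      using decomp[OF g] by blast
    have qc: "q \<in> carrier G" using q r by auto
    have "\<forall>q\<in>{\<one>, a, b, a \<otimes> b}. (\<exists>k\<in>carrier K8. embed_K8 a b k = q) \<and>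
        (\<exists>k\<in>carrier K8. embed_K8 a b k = z \<otimes> q)"
      by (simp add: K8_def embed_K8_def r)
    then obtain k k' where k: "k \<in> carrier K8" "embed_K8 a b k = q"
      and k': "k' \<in> carrier K8" "embed_K8 a b k' = z \<otimes> q"
      using q by blast
    have "(z \<otimes> q) \<otimes> (z \<otimes> c) = (q \<otimes> z) \<otimes> (z \<otimes> c)"
      using central[of z q] r qc by simp
    also have "\<dots> = q \<otimes> c" using r qc c by (simp add: m_assoc)
    finally have "g = embed_K8 a b k' \<otimes> (z \<otimes> c)" using gqc k' by simp
    moreover have "g = embed_K8 a b k \<otimes> c" using gqc k by simp
    moreover have "c \<in> E \<or> z \<otimes> c \<in> E" using C_cases c by (simp add: C_def)
    ultimately obtain k e where "k \<in> carrier K8" "e \<in> E" "g = embed_K8 a b k \<otimes> e"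
      using k(1) k'(1) by blast
    then show "g \<in> f ` carrier (K8 \<times>\<times> E')"
      by (auto simp: f_def E'_simps intro!: image_eqI[of _ _ "(k, e)"])
  qed
  ultimately have "f \<in> iso (K8 \<times>\<times> E') G"
    using f.homh by (auto simp: iso_def bij_betw_def hom_def)
  then have "G \<cong> K8 \<times>\<times> E'" using P.iso_sym by (auto simp: is_iso_def)
  then show ?thesis using elementary_abelian_2_factor_type[OF group_axioms el] by simp
qed

end

section \<open>Units of the integral group ring of K8\<close>

definition group_ring_map :: "('a \<Rightarrow> 'b) \<Rightarrow> ('a \<Rightarrow>\<^sub>0 int) \<Rightarrow> ('b \<Rightarrow>\<^sub>0 int)" where
  "group_ring_map \<pi> a = frag_extend (\<lambda>x. frag_of (\<pi> x)) a"

lemma group_ring_map_frag_of [simp]: "group_ring_map \<pi> (frag_of x) = frag_of (\<pi> x)"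
  by (simp add: group_ring_map_def)

lemma group_ring_map_diff: "group_ring_map \<pi> (a - b) = group_ring_map \<pi> a - group_ring_map \<pi> b"
  by (simp add: group_ring_map_def frag_extend_diff)

lemma keys_group_ring_map:
  "Poly_Mapping.keys a \<subseteq> H \<Longrightarrow> Poly_Mapping.keys (group_ring_map \<pi> a) \<subseteq> \<pi> ` H"
  unfolding group_ring_map_def by (intro order_trans[OF keys_frag_extend]) auto

lemma group_ring_map_mult:
  assumes "\<And>x y. x \<in> H \<Longrightarrow> y \<in> H \<Longrightarrow> \<pi> (x \<otimes>\<^bsub>G\<^esub> y) = \<pi> x \<otimes>\<^bsub>K\<^esub> \<pi> y"
    and "Poly_Mapping.keys a \<subseteq> H" "Poly_Mapping.keys b \<subseteq> H"
  shows "group_ring_map \<pi> (a \<otimes>\<^bsub>group_ring G\<^esub> b) =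
    group_ring_map \<pi> a \<otimes>\<^bsub>group_ring K\<^esub> group_ring_map \<pi> b"
  by (rule additive_map_mult[where F = "group_ring_map \<pi>" and mul = "\<lambda>p q. p \<otimes>\<^bsub>group_ring K\<^esub> q", OF _ _ _ _ assms(2,3)])
     (simp_all add: group_ring_map_diff group_ring_mult_diff assms(1))

lemma lookup_group_ring_map:
  assumes "inj_on \<pi> H" "x \<in> H" "Poly_Mapping.keys a \<subseteq> H"
  shows "Poly_Mapping.lookup (group_ring_map \<pi> a) (\<pi> x) = Poly_Mapping.lookup a x"
  using assms(3)
proof (induction a rule: frag_induction)
  case (one y)
  then show ?case using assms(1,2) by (auto simp: inj_on_def)
qed (auto simp: group_ring_map_diff lookup_minus, simp add: group_ring_map_def)

definition quat_norm :: "int_quat \<Rightarrow> int" where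
  "quat_norm = (\<lambda>(p, q, r, s). p\<^sup>2 + q\<^sup>2 + r\<^sup>2 + s\<^sup>2)"

lemma quat_norm_mult: "quat_norm (quat_mult x y) = quat_norm x * quat_norm y"
  by (cases x; cases y) (simp add: quat_norm_def power2_eq_square algebra_simps)

lemma quat_mult_diff:
  "quat_mult (x - y) w = quat_mult x w - quat_mult y w"
  "quat_mult w (x - y) = quat_mult w x - quat_mult w y"
  by (cases x; cases y; cases w; simp add: algebra_simps)+

text \<open>
  The quaternion representation of the group ring of \<^const>\<open>K8\<close>, by integer quaternions.
\<close>

definition quat_eval :: "(int_quat \<Rightarrow>\<^sub>0 int) \<Rightarrow> int_quat" where
  "quat_eval a =
    (\<Sum>k\<in>carrier K8. Poly_Mapping.lookup a k * fst k,
     \<Sum>k\<in>carrier K8. Poly_Mapping.lookup a k * fst (snd k),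
     \<Sum>k\<in>carrier K8. Poly_Mapping.lookup a k * fst (snd (snd k)),
     \<Sum>k\<in>carrier K8. Poly_Mapping.lookup a k * snd (snd (snd k)))"

lemma finite_K8: "finite (carrier K8)"
  by (simp add: K8_def)

lemma mult_K8: "monoid.mult K8 = quat_mult"
  by (simp add: K8_def)

lemma quat_eval_diff: "quat_eval (a - b) = quat_eval a - quat_eval b"
  by (simp add: quat_eval_def lookup_minus left_diff_distrib sum_subtractf)

lemma quat_eval_frag_of: "x \<in> carrier K8 \<Longrightarrow> quat_eval (frag_of x) = x"
  by (cases x) (simp add: quat_eval_def finite_K8 if_distrib[of "\<lambda>t. t * _"] cong: if_cong)

lemma K8_mult_closed: "x \<in> carrier K8 \<Longrightarrow> y \<in> carrier K8 \<Longrightarrow> quat_mult x y \<in> carrier K8"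
  using monoid.m_closed[OF group.axioms(1)[OF group_K8]] by (simp add: mult_K8)

lemma quat_eval_mult:
  assumes "Poly_Mapping.keys a \<subseteq> carrier K8" "Poly_Mapping.keys b \<subseteq> carrier K8"
  shows "quat_eval (a \<otimes>\<^bsub>group_ring K8\<^esub> b) = quat_mult (quat_eval a) (quat_eval b)"
  by (rule additive_map_mult[where F = quat_eval and mul = quat_mult, OF _ _ _ _ assms])
     (simp_all add: quat_eval_diff quat_mult_diff quat_eval_frag_of mult_K8 K8_mult_closed)

text \<open>
  For \<open>N\<close> of index at most two in \<^const>\<open>K8\<close>, the linear extension of the character with values
  \<open>1\<close> and \<open>-1\<close> whose kernel is \<open>N\<close>.
\<close>

definition sign_eval :: "int_quat set \<Rightarrow> (int_quat \<Rightarrow>\<^sub>0 int) \<Rightarrow> int" where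
  "sign_eval N a = (\<Sum>k\<in>carrier K8. Poly_Mapping.lookup a k * (if k \<in> N then 1 else -1))"

lemma sign_eval_unit:
  assumes N: "\<forall>x\<in>carrier K8. \<forall>y\<in>carrier K8. quat_mult x y \<in> N \<longleftrightarrow> (x \<in> N \<longleftrightarrow> y \<in> N)"
    and u: "Poly_Mapping.keys u \<subseteq> carrier K8" and v: "Poly_Mapping.keys v \<subseteq> carrier K8"
    and uv: "u \<otimes>\<^bsub>group_ring K8\<^esub> v = frag_of \<one>\<^bsub>K8\<^esub>"
  shows "(sign_eval N u)\<^sup>2 = 1"
proof -
  have of: "sign_eval N (frag_of k) = (if k \<in> N then 1 else -1)" if "k \<in> carrier K8" for k
    using that finite_K8
    by (simp add: sign_eval_def if_distrib[of "\<lambda>t. t * _"] cong: if_cong)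
  have "sign_eval N (u \<otimes>\<^bsub>group_ring K8\<^esub> v) = sign_eval N u * sign_eval N v"
  proof (rule additive_map_mult[where F = "sign_eval N" and mul = "(*)", OF _ _ _ _ u v])
    show "sign_eval N (a - b) = sign_eval N a - sign_eval N b" for a b
      by (simp add: sign_eval_def lookup_minus left_diff_distrib sum_subtractf)
    show "sign_eval N (frag_of (x \<otimes>\<^bsub>K8\<^esub> y)) = sign_eval N (frag_of x) * sign_eval N (frag_of y)"
      if "x \<in> carrier K8" "y \<in> carrier K8" for x y
      using that bspec[OF bspec[OF N that(1)] that(2)] by (simp add: mult_K8 K8_mult_closed of)
  qed (simp_all add: algebra_simps)
  moreover have "\<one>\<^bsub>K8\<^esub> \<in> carrier K8" by (simp add: K8_def)
  then have "(sign_eval N (frag_of \<one>\<^bsub>K8\<^esub>))\<^sup>2 = 1" by (simp add: of)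
  ultimately have "(sign_eval N u * sign_eval N v)\<^sup>2 = 1" unfolding uv by simp
  then have "\<bar>sign_eval N u * sign_eval N v\<bar> = 1" by (simp add: abs_square_eq_1)
  then have "\<bar>sign_eval N u\<bar> = 1" by (simp add: abs_mult zmult_eq_1_iff) linarith
  then show ?thesis by (simp add: abs_square_eq_1)
qed

text \<open>
  This is Parseval's identity for \<^const>\<open>K8\<close>: eight times the sum of the squares of the coefficients
  is the sum of the squares of the four linear characters plus four times the norm of the quaternion
  representation. On a unit the linear characters are \<open>1\<close> or \<open>-1\<close>, and the norm, being multiplicative
  and a nonnegative integer, is \<open>1\<close>. So the total is \<open>8\<close>.
\<close>

lemma K8_unit_sum_squares:
  assumes u: "Poly_Mapping.keys u \<subseteq> carrier K8" and v: "Poly_Mapping.keys v \<subseteq> carrier K8"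
    and uv: "u \<otimes>\<^bsub>group_ring K8\<^esub> v = frag_of \<one>\<^bsub>K8\<^esub>"
  shows "(\<Sum>k\<in>carrier K8. (Poly_Mapping.lookup u k)\<^sup>2) = 1"
proof -
  let ?c = "Poly_Mapping.lookup u"
  have "\<one>\<^bsub>K8\<^esub> \<in> carrier K8" by (simp add: K8_def)
  then have "quat_mult (quat_eval u) (quat_eval v) = \<one>\<^bsub>K8\<^esub>"
    by (simp only: quat_eval_mult[OF u v, symmetric] uv quat_eval_frag_of)
  then have "quat_norm (quat_eval u) * quat_norm (quat_eval v) = 1"
    unfolding quat_norm_mult[symmetric] by (simp add: quat_norm_def K8_def)
  moreover have "quat_norm x \<ge> 0" for x by (cases x) (simp add: quat_norm_def)
  ultimately have norm: "quat_norm (quat_eval u) = 1"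
    by (metis zmult_eq_1_iff zero_le_one not_one_le_zero neg_0_le_iff_le)
  define NI :: "int_quat set" where "NI = {(p, q, r, s). r = 0 \<and> s = 0}"
  define NJ :: "int_quat set" where "NJ = {(p, q, r, s). q = 0 \<and> s = 0}"
  define NK :: "int_quat set" where "NK = {(p, q, r, s). q = 0 \<and> r = 0}"
  have s1: "(sign_eval UNIV u)\<^sup>2 = 1" by (rule sign_eval_unit[OF _ u v uv]) simp
  have s2: "(sign_eval NI u)\<^sup>2 = 1"
    by (rule sign_eval_unit[OF _ u v uv]) (simp add: K8_def NI_def)
  have s3: "(sign_eval NJ u)\<^sup>2 = 1"
    by (rule sign_eval_unit[OF _ u v uv]) (simp add: K8_def NJ_def)
  have s4: "(sign_eval NK u)\<^sup>2 = 1"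
    by (rule sign_eval_unit[OF _ u v uv]) (simp add: K8_def NK_def)
  \<comment> \<open>The kernels of the linear characters are \<open>K8\<close> and its subgroups generated by \<open>i, j, k\<close>, cut out by \<open>NI, NJ, NK\<close>.\<close>
  have "8 * (\<Sum>k\<in>carrier K8. (?c k)\<^sup>2) = (sign_eval UNIV u)\<^sup>2 + (sign_eval NI u)\<^sup>2
      + (sign_eval NJ u)\<^sup>2 + (sign_eval NK u)\<^sup>2 + 4 * quat_norm (quat_eval u)"
    by (simp add: sign_eval_def quat_eval_def quat_norm_def K8_def NI_def NJ_def NK_def
        power2_eq_square algebra_simps)
  then show ?thesis using s1 s2 s3 s4 norm by simp
qed

section \<open>Adjoining central involutions\<close>

context group
begin

interpretation ZG: ring "group_ring G"
  by (rule ring_group_ring) (rule monoid_axioms)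

text \<open>
  The group ring of a subgroup \<open>H\<close> is regarded as the set of elements of the group ring of \<open>G\<close> supported
  on \<open>H\<close>, so that the induction over subgroups takes place in a single ring.
\<close>

definition trivial_units_on :: "'a set \<Rightarrow> bool" where
  "trivial_units_on H \<longleftrightarrow> (\<forall>u v. Poly_Mapping.keys u \<subseteq> H \<longrightarrow> Poly_Mapping.keys v \<subseteq> H \<longrightarrow>
     u \<star> v = frag_of \<one> \<longrightarrow> (\<exists>g\<in>H. u = frag_of g \<or> u = - frag_of g))"

lemma keys_mult_subgroup:
  assumes "subgroup H G" "Poly_Mapping.keys a \<subseteq> H" "Poly_Mapping.keys b \<subseteq> H"
  shows "Poly_Mapping.keys (a \<star> b) \<subseteq> H"
proof -
  have "frag_extend (\<lambda>x. frag_extend (\<lambda>y. frag_of (x \<otimes> y)) b) a =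
      a \<otimes>\<^bsub>group_ring (G\<lparr>carrier := H\<rparr>)\<^esub> b"
    by (simp add: group_ring_simps)
  then show ?thesis
    using group_ring_mult_closed[of "G\<lparr>carrier := H\<rparr>" a b] assms
      group.is_monoid[OF subgroup.subgroup_is_group[OF assms(1) group_axioms]]
    by (simp add: group_ring_simps)
qed

lemma central_involution_decomposition:
  assumes H: "subgroup H G" and t: "t \<in> carrier G"
    and u: "Poly_Mapping.keys u \<subseteq> H \<union> (\<lambda>h. t \<otimes> h) ` H"
  obtains \<alpha> \<beta> where "Poly_Mapping.keys \<alpha> \<subseteq> H" "Poly_Mapping.keys \<beta> \<subseteq> H"
    "u = \<alpha> + frag_of t \<star> \<beta>"
proof -
  from u have "\<exists>\<alpha> \<beta>. Poly_Mapping.keys \<alpha> \<subseteq> H \<and> Poly_Mapping.keys \<beta> \<subseteq> H \<and> u = \<alpha> + frag_of t \<star> \<beta>"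
  proof (induction u rule: frag_induction)
    case zero
    show ?case by (intro exI[of _ 0]) simp
  next
    case (one x)
    then consider "x \<in> H" | h where "h \<in> H" "x = t \<otimes> h" by blast
    then show ?case
    proof cases
      case 1
      then show ?thesis by (intro exI[of _ "frag_of x"] exI[of _ 0]) simp
    next
      case 2
      then show ?thesis by (intro exI[of _ 0] exI[of _ "frag_of h"]) simp
    qed
  next
    case (diff a b)
    then obtain \<alpha> \<beta> \<alpha>' \<beta>' where
      "Poly_Mapping.keys \<alpha> \<subseteq> H" "Poly_Mapping.keys \<beta> \<subseteq> H" "a = \<alpha> + frag_of t \<star> \<beta>"
      "Poly_Mapping.keys \<alpha>' \<subseteq> H" "Poly_Mapping.keys \<beta>' \<subseteq> H" "b = \<alpha>' + frag_of t \<star> \<beta>'"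
      by blast
    then show ?case
      using keys_diff[of \<alpha> \<alpha>'] keys_diff[of \<beta> \<beta>']
      by (intro exI[of _ "\<alpha> - \<alpha>'"] exI[of _ "\<beta> - \<beta>'"]) (auto simp: group_ring_mult_diff)
  qed
  then show ?thesis using that by blast
qed

text \<open>
  Modulo two, \<open>\<alpha> + \<beta>\<close> and \<open>\<alpha> - \<beta>\<close> agree, so \<open>g = h\<close>; hence the two are equal or opposite.
\<close>

lemma sum_diff_trivial:
  fixes \<alpha> \<beta> :: "'a \<Rightarrow>\<^sub>0 int"
  assumes "\<alpha> + \<beta> = frag_of g \<or> \<alpha> + \<beta> = - frag_of g"
    and "\<alpha> - \<beta> = frag_of h \<or> \<alpha> - \<beta> = - frag_of h"
  shows "\<beta> = 0 \<or> \<alpha> = 0"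
proof -
  have "Poly_Mapping.lookup (\<alpha> + \<beta>) g = Poly_Mapping.lookup (\<alpha> - \<beta>) g + 2 * Poly_Mapping.lookup \<beta> g"
    by (simp add: lookup_add lookup_minus)
  moreover have "odd (Poly_Mapping.lookup (\<alpha> + \<beta>) g)" using assms(1) by auto
  ultimately have "odd (Poly_Mapping.lookup (\<alpha> - \<beta>) g)" by simp
  then have gh: "g = h" using assms(2) by (auto split: if_splits)
  have *: "x = 0" if "x + x = (0 :: 'a \<Rightarrow>\<^sub>0 int)" for x
    using that frag_cmul_distrib[of 1 1 x] by simp
  have 1: "(\<alpha> + \<beta>) - (\<alpha> - \<beta>) = \<beta> + \<beta>" and 2: "(\<alpha> + \<beta>) + (\<alpha> - \<beta>) = \<alpha> + \<alpha>" by simp_all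
  have "(\<alpha> + \<beta>) - (\<alpha> - \<beta>) = 0 \<or> (\<alpha> + \<beta>) + (\<alpha> - \<beta>) = 0"
    using assms unfolding gh by (elim disjE) (simp_all only: simp_thms diff_self right_minus left_minus)
  then show ?thesis unfolding 1 2 using * by blast
qed

text \<open>
  Higman's argument. Sending the central involution \<open>t\<close> to \<open>1\<close> or to \<open>-1\<close> maps a unit \<open>\<alpha> + t \<beta>\<close> to the
  units \<open>\<alpha> + \<beta>\<close> and \<open>\<alpha> - \<beta>\<close> supported on \<open>H\<close>. Both are trivial, so \<open>\<alpha>\<close> or \<open>\<beta>\<close> is zero.
\<close>

lemma trivial_units_on_extend:
  assumes H: "subgroup H G" and triv: "trivial_units_on H"
    and t: "t \<in> carrier G" "t \<notin> H" "t \<otimes> t = \<one>"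
    and central: "\<And>x. x \<in> carrier G \<Longrightarrow> t \<otimes> x = x \<otimes> t"
  shows "trivial_units_on (H \<union> (\<lambda>h. t \<otimes> h) ` H)"
  unfolding trivial_units_on_def
proof (intro allI impI)
  interpret H: subgroup H G by fact
  fix u v assume u: "Poly_Mapping.keys u \<subseteq> H \<union> (\<lambda>h. t \<otimes> h) ` H"
    and v: "Poly_Mapping.keys v \<subseteq> H \<union> (\<lambda>h. t \<otimes> h) ` H" and uv: "u \<star> v = frag_of \<one>"
  obtain \<alpha> \<beta> where ab: "Poly_Mapping.keys \<alpha> \<subseteq> H" "Poly_Mapping.keys \<beta> \<subseteq> H" "u = \<alpha> + frag_of t \<star> \<beta>"
    using central_involution_decomposition[OF H t(1) u] .
  obtain \<gamma> \<delta> where cd: "Poly_Mapping.keys \<gamma> \<subseteq> H" "Poly_Mapping.keys \<delta> \<subseteq> H" "v = \<gamma> + frag_of t \<star> \<delta>"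
    using central_involution_decomposition[OF H t(1) v] .
  have carr: "a \<in> carrier (group_ring G)" if "Poly_Mapping.keys a \<subseteq> H" for a
    using that H.subset by (auto simp: group_ring_carrier_iff)
  note c = carr[OF ab(1)] carr[OF ab(2)] carr[OF cd(1)] carr[OF cd(2)]
  have comm: "a \<star> frag_of t = frag_of t \<star> a" if "a \<in> carrier (group_ring G)" for a
    using that unfolding group_ring_carrier_iff
    by (induction a rule: frag_induction) (auto simp: group_ring_mult_diff central)
  have tt: "frag_of t \<star> (frag_of t \<star> a) = a" if "a \<in> carrier (group_ring G)" for a
    using that t by (simp add: ZG.m_assoc[symmetric])
  have tc: "frag_of t \<in> carrier (group_ring G)" using t by simp
  have comm': "a \<star> (frag_of t \<star> b) = frag_of t \<star> (a \<star> b)"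
    if "a \<in> carrier (group_ring G)" "b \<in> carrier (group_ring G)" for a b
    using that tc comm[OF that(1)] by (simp add: ZG.m_assoc[symmetric])
  define A where "A = \<alpha> \<star> \<gamma> + \<beta> \<star> \<delta>"
  define B where "B = \<alpha> \<star> \<delta> + \<beta> \<star> \<gamma>"
  have AB: "A + frag_of t \<star> B = frag_of \<one>"
  proof -
    have 1: "\<alpha> \<star> (frag_of t \<star> \<delta>) = frag_of t \<star> (\<alpha> \<star> \<delta>)" by (rule comm'[OF c(1) c(4)])
    have "\<beta> \<star> (frag_of t \<star> \<delta>) = frag_of t \<star> (\<beta> \<star> \<delta>)" by (rule comm'[OF c(2) c(4)])
    then have 2: "(frag_of t \<star> \<beta>) \<star> (frag_of t \<star> \<delta>) = \<beta> \<star> \<delta>"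
      using c tc tt[of "\<beta> \<star> \<delta>"] by (simp add: ZG.m_assoc)
    have 3: "(frag_of t \<star> \<beta>) \<star> \<gamma> = frag_of t \<star> (\<beta> \<star> \<gamma>)" using c tc by (simp add: ZG.m_assoc)
    show ?thesis
      unfolding uv[symmetric] A_def B_def ab(3) cd(3) group_ring_mult_add 1 2 3
      by (simp only: add_ac)
  qed
  have AH: "Poly_Mapping.keys A \<subseteq> H" and BH: "Poly_Mapping.keys B \<subseteq> H"
    unfolding A_def B_def using ab cd
    by (auto dest!: subsetD[OF keys_add] subsetD[OF keys_mult_subgroup[OF H], rotated -1])
  \<comment> \<open>The summands \<open>A\<close> and \<open>t B\<close> are supported on the disjoint cosets \<open>H\<close> and \<open>t H\<close>.\<close>
  have B0: "B = 0"
  proof (rule poly_mapping_eqI)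
    fix h
    show "Poly_Mapping.lookup B h = Poly_Mapping.lookup 0 h"
    proof (cases "h \<in> H")
      case True
      have th: "t \<otimes> h \<notin> H"
      proof
        assume "t \<otimes> h \<in> H"
        then have "(t \<otimes> h) \<otimes> inv h \<in> H" using True by simp
        then show False using True t by (simp add: m_assoc)
      qed
      have "Poly_Mapping.lookup (A + frag_of t \<star> B) (t \<otimes> h) = 0"
        unfolding AB using th H.one_closed by auto
      moreover have "Poly_Mapping.lookup A (t \<otimes> h) = 0"
        using AH th by (auto simp: in_keys_iff)
      moreover have "Poly_Mapping.lookup (frag_of t \<star> B) (t \<otimes> h) = Poly_Mapping.lookup B h"
      proof -
        have "Poly_Mapping.lookup (frag_of t \<star> B) (t \<otimes> h) = Poly_Mapping.lookup B (inv t \<otimes> (t \<otimes> h))"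
          using True t carr[OF BH] by (intro lookup_frag_of_mult) auto
        then show ?thesis using True t by (simp add: m_assoc[symmetric])
      qed
      ultimately show ?thesis by (simp add: lookup_add)
    next
      case False
      then show ?thesis using BH by (auto simp: in_keys_iff)
    qed
  qed
  then have A1: "A = frag_of \<one>" using AB by simp
  have "(\<alpha> + \<beta>) \<star> (\<gamma> + \<delta>) = A + B" "(\<alpha> - \<beta>) \<star> (\<gamma> - \<delta>) = A - B"
    by (simp_all add: A_def B_def group_ring_mult_add group_ring_mult_diff)
  then have "(\<alpha> + \<beta>) \<star> (\<gamma> + \<delta>) = frag_of \<one>" "(\<alpha> - \<beta>) \<star> (\<gamma> - \<delta>) = frag_of \<one>"
    by (simp_all add: A1 B0)
  moreover have "Poly_Mapping.keys (\<alpha> + \<beta>) \<subseteq> H" "Poly_Mapping.keys (\<alpha> - \<beta>) \<subseteq> H"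
    "Poly_Mapping.keys (\<gamma> + \<delta>) \<subseteq> H" "Poly_Mapping.keys (\<gamma> - \<delta>) \<subseteq> H"
    using ab cd keys_add[of \<alpha> \<beta>] keys_diff[of \<alpha> \<beta>] keys_add[of \<gamma> \<delta>] keys_diff[of \<gamma> \<delta>] by blast+
  ultimately obtain g h where g: "g \<in> H" "\<alpha> + \<beta> = frag_of g \<or> \<alpha> + \<beta> = - frag_of g"
    and h: "h \<in> H" "\<alpha> - \<beta> = frag_of h \<or> \<alpha> - \<beta> = - frag_of h"
    using triv unfolding trivial_units_on_def by meson
  from sum_diff_trivial[OF g(2) h(2)]
  show "\<exists>g\<in>H \<union> (\<lambda>h. t \<otimes> h) ` H. u = frag_of g \<or> u = - frag_of g"
  proof
    assume "\<beta> = 0"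
    then have "u = frag_of g \<or> u = - frag_of g" using g(2) ab(3) by simp
    then show ?thesis using g(1) by blast
  next
    assume "\<alpha> = 0"
    then have "u = frag_of (t \<otimes> g) \<or> u = - frag_of (t \<otimes> g)"
      using g(2) ab(3) by (auto simp: group_ring_mult_uminus)
    then show ?thesis using g(1) by blast
  qed
qed

lemma trivial_units_on_K8:
  assumes Q: "subgroup Q G" and hom: "\<pi> \<in> hom G K8" and bij: "bij_betw \<pi> Q (carrier K8)"
  shows "trivial_units_on Q"
  unfolding trivial_units_on_def
proof (intro allI impI)
  interpret Q: subgroup Q G by fact
  fix u v assume u: "Poly_Mapping.keys u \<subseteq> Q" and v: "Poly_Mapping.keys v \<subseteq> Q"
    and uv: "u \<star> v = frag_of \<one>"
  have inj: "inj_on \<pi> Q" and im: "\<pi> ` Q = carrier K8" using bij by (auto simp: bij_betw_def)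
  have "group_ring_map \<pi> (u \<star> v) = group_ring_map \<pi> u \<otimes>\<^bsub>group_ring K8\<^esub> group_ring_map \<pi> v"
    using hom u v by (intro group_ring_map_mult[where H = Q]) (auto simp: hom_def)
  moreover have "\<pi> \<one> = \<one>\<^bsub>K8\<^esub>" using hom_one[OF hom group_axioms group_K8] .
  ultimately have "(\<Sum>k\<in>carrier K8. (Poly_Mapping.lookup (group_ring_map \<pi> u) k)\<^sup>2) = 1"
    using keys_group_ring_map[OF u, of \<pi>] keys_group_ring_map[OF v, of \<pi>]
    by (intro K8_unit_sum_squares[of _ "group_ring_map \<pi> v"]) (simp_all add: uv im)
  then have "(\<Sum>x\<in>Q. (Poly_Mapping.lookup u x)\<^sup>2) = 1"
    by (simp add: sum.reindex_bij_betw[OF bij, symmetric] lookup_group_ring_map[OF inj _ u])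
  moreover have "finite Q" using bij finite_K8 bij_betw_finite by blast
  ultimately show "\<exists>g\<in>Q. u = frag_of g \<or> u = - frag_of g"
    using trivial_unit_of_sum_squares u by blast
qed

text \<open>
  The factor \<^const>\<open>K8\<close> has trivial units, and every element of \<open>G\<close> outside a subgroup \<open>H\<close> that contains
  this factor yields a central involution outside \<open>H\<close>. So a maximal subgroup among those that contain
  the factor and have trivial units is all of \<open>G\<close>.
\<close>

lemma trivial_units_K8_times_elementary_abelian:
  assumes fin: "finite (carrier G)" and E: "elementary_abelian_2_group E"
    and f: "f \<in> iso G (K8 \<times>\<times> E)"
  shows "trivial_units_on (carrier G)"
proof -
  interpret E: comm_group E using E by (simp add: elementary_abelian_2_group_def)
  interpret K8: group K8 by (rule group_K8)
  interpret P: group "K8 \<times>\<times> E" by (intro DirProd_group K8.group_axioms E.group_axioms)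
  interpret f: group_hom G "K8 \<times>\<times> E" f
    using f by (intro group_hom.intro group_hom_axioms.intro P.group_axioms group_axioms) (simp add: iso_def)
  have fbij: "bij_betw f (carrier G) (carrier K8 \<times> carrier E)" using f by (simp add: iso_def)
  then have finj: "inj_on f (carrier G)" by (simp add: bij_betw_def)
  define \<pi> where "\<pi> = fst \<circ> f"
  define \<eta> where "\<eta> = snd \<circ> f"
  have fx: "f x = (\<pi> x, \<eta> x)" for x by (simp add: \<pi>_def \<eta>_def)
  have mem: "\<pi> x \<in> carrier K8" "\<eta> x \<in> carrier E" if "x \<in> carrier G" for x
    using f.hom_closed[OF that] by (auto simp: fx)
  have mult: "\<pi> (x \<otimes> y) = \<pi> x \<otimes>\<^bsub>K8\<^esub> \<pi> y" "\<eta> (x \<otimes> y) = \<eta> x \<otimes>\<^bsub>E\<^esub> \<eta> y"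
    if "x \<in> carrier G" "y \<in> carrier G" for x y
    using f.hom_mult[OF that] by (simp_all add: fx)
  have one: "\<pi> \<one> = \<one>\<^bsub>K8\<^esub>" "\<eta> \<one> = \<one>\<^bsub>E\<^esub>" using f.hom_one by (simp_all add: fx)
  have eqI: "x = y" if "x \<in> carrier G" "y \<in> carrier G" "\<pi> x = \<pi> y" "\<eta> x = \<eta> y" for x y
    using that finj by (auto simp: inj_on_def fx)
  have surj: "\<exists>x\<in>carrier G. \<pi> x = k \<and> \<eta> x = e" if "k \<in> carrier K8" "e \<in> carrier E" for k e
  proof -
    have "(k, e) \<in> f ` carrier G" using fbij that by (auto simp: bij_betw_def)
    then show ?thesis by (force simp: fx)
  qed
  define Q where "Q = {x \<in> carrier G. \<eta> x = \<one>\<^bsub>E\<^esub>}"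
  have \<pi>hom: "\<pi> \<in> hom G K8" and \<eta>hom: "\<eta> \<in> hom G E"
    using mem mult by (auto simp: hom_def)
  interpret \<eta>: group_hom G E \<eta>
    by (intro group_hom.intro group_hom_axioms.intro group_axioms E.group_axioms \<eta>hom)
  have Q: "subgroup Q G"
    using \<eta>.subgroup_kernel by (simp add: kernel_def Q_def)
  have "bij_betw \<pi> Q (carrier K8)"
    unfolding bij_betw_def
  proof
    show "inj_on \<pi> Q" by (rule inj_onI) (auto simp: Q_def intro: eqI)
    show "\<pi> ` Q = carrier K8"
      using surj[OF _ E.one_closed] mem by (force simp: Q_def)
  qed
  then have trivQ: "trivial_units_on Q" by (rule trivial_units_on_K8[OF Q \<pi>hom])
  define S where "S = {H. subgroup H G \<and> Q \<subseteq> H \<and> trivial_units_on H}"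
  have "finite S"
    using fin by (intro finite_subset[of S "Pow (carrier G)"]) (auto simp: S_def dest: subgroup.subset)
  moreover have "Q \<in> S" using Q trivQ by (simp add: S_def)
  ultimately obtain H where HS: "H \<in> S" and max: "\<And>K. K \<in> S \<Longrightarrow> H \<subseteq> K \<Longrightarrow> K = H"
    using finite_has_maximal[of S] by blast
  have H: "subgroup H G" and QH: "Q \<subseteq> H" and trivH: "trivial_units_on H"
    using HS by (auto simp: S_def)
  interpret H: subgroup H G by fact
  have "carrier G \<subseteq> H"
  proof (rule ccontr)
    assume "\<not> carrier G \<subseteq> H"
    then obtain g where g: "g \<in> carrier G" "g \<notin> H" by blast
    obtain q where q: "q \<in> carrier G" "\<pi> q = \<pi> g" "\<eta> q = \<one>\<^bsub>E\<^esub>"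
      using surj[of "\<pi> g" "\<one>\<^bsub>E\<^esub>"] mem[OF g(1)] by auto
    obtain t where t: "t \<in> carrier G" "\<pi> t = \<one>\<^bsub>K8\<^esub>" "\<eta> t = \<eta> g"
      using surj[of "\<one>\<^bsub>K8\<^esub>" "\<eta> g"] mem[OF g(1)] by auto
    have "g = q \<otimes> t" using g q t mem[OF g(1)] by (intro eqI) (auto simp: mult)
    moreover have "q \<in> H" using q QH by (auto simp: Q_def)
    ultimately have tH: "t \<notin> H" using g(2) by auto
    have tt: "t \<otimes> t = \<one>"
      using t mem[OF g(1)] E one by (intro eqI) (auto simp: mult elementary_abelian_2_group_def)
    have tc: "t \<otimes> x = x \<otimes> t" if "x \<in> carrier G" for x
      using t that mem[OF that] mem[OF g(1)] by (intro eqI) (auto simp: mult E.m_comm)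
    define K where "K = H \<union> (\<lambda>h. t \<otimes> h) ` H"
    have "subgroup K G"
    proof (rule subgroupI)
      show "K \<subseteq> carrier G" using t H.subset by (auto simp: K_def)
      show "K \<noteq> {}" using H.one_closed unfolding K_def by blast
      have 1: "t \<otimes> (t \<otimes> x) = x" if "x \<in> carrier G" for x
        using that t tt by (simp add: m_assoc[symmetric])
      have 2: "x \<otimes> (t \<otimes> y) = t \<otimes> (x \<otimes> y)" if "x \<in> H" "y \<in> carrier G" for x y
        using that t tc[of x] by (simp add: m_assoc[symmetric])
      show "x \<otimes> y \<in> K" if "x \<in> K" "y \<in> K" for x y
        using that t 1 2 by (auto simp: K_def m_assoc)
      have "inv t = t" using tt t by (intro inv_equality)
      then show "inv x \<in> K" if "x \<in> K" for x
        using that t tc by (auto simp: K_def inv_mult_group)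
    qed
    moreover have "trivial_units_on K"
      unfolding K_def by (rule trivial_units_on_extend[OF H trivH t(1) tH tt tc])
    ultimately have "K \<in> S" using QH by (auto simp: S_def K_def)
    then have "K = H" by (rule max) (auto simp: K_def)
    moreover have "t \<in> (\<lambda>h. t \<otimes> h) ` H" by (rule image_eqI[of _ _ \<one>]) (use t in auto)
    ultimately show False using tH unfolding K_def by blast
  qed
  then have "H = carrier G" using H.subset by blast
  then show ?thesis using trivH by simp
qed

end

section \<open>Group elements congruent to one modulo a power of the augmentation ideal\<close>

context group
begin

interpretation ZG: ring "group_ring G"
  by (rule ring_group_ring) (rule monoid_axioms)

lemma augmentation_ideal_carrier: "a \<in> augmentation_ideal G \<Longrightarrow> a \<in> carrier (group_ring G)"
  by (simp add: augmentation_ideal_iff group_ring_carrier_iff)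

text \<open>
  Extend \<open>f\<close> to an additive map \<open>h\<close> from the group ring to \<open>A\<close>. It is trivial on each product
  \<open>(x - 1) (y - 1) = x y - x - y + 1\<close>, since \<open>A\<close> is commutative, and therefore on \<open>\<Delta>\<^sup>2\<close>; but its value
  at \<open>g - 1\<close> is \<open>f g\<close>.
\<close>

lemma hom_trivial_of_augmentation_ideal_square:
  fixes A (structure)
  assumes A: "comm_group A" and f: "f \<in> hom G A" and g: "g \<in> carrier G"
    and mem: "frag_of g - frag_of \<one>\<^bsub>G\<^esub> \<in> augmentation_ideal_power G 2"
  shows "f g = \<one>\<^bsub>A\<^esub>"
proof -
  interpret A: comm_group A by fact
  interpret f: group_hom G A f
    by (intro group_hom.intro group_hom_axioms.intro group_axioms A.group_axioms f)
  obtain h where h: "h \<in> hom (free_Abelian_group (carrier G)) A"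
    and hf: "\<And>x. x \<in> carrier G \<Longrightarrow> h (frag_of x) = f x"
    using A.free_Abelian_group_universal[of f "carrier G"] f.hom_closed by blast
  have h_closed: "h a \<in> carrier A" if "a \<in> carrier (group_ring G)" for a
    using h that by (auto simp: hom_def group_ring_carrier_iff)
  have h_add: "h (a + b) = h a \<otimes>\<^bsub>A\<^esub> h b"
    if "a \<in> carrier (group_ring G)" "b \<in> carrier (group_ring G)" for a b
    using h that by (auto simp: hom_def group_ring_carrier_iff)
  have h_diff: "h (a - b) = h a \<otimes>\<^bsub>A\<^esub> inv\<^bsub>A\<^esub> h b"
    if "a \<in> carrier (group_ring G)" "b \<in> carrier (group_ring G)" for a b
    using that h_add[of "a - b" b] h_closed[of "a - b"] h_closed[of b] h_closed[of a]
    by (simp add: A.m_assoc)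
  have h_zero: "h 0 = \<one>\<^bsub>A\<^esub>" using h_diff[of 0 0] h_closed[of 0] by simp
  have prod: "h (a \<star> b) = \<one>\<^bsub>A\<^esub>" if a: "a \<in> augmentation_ideal G" and b: "b \<in> augmentation_ideal G" for a b
  proof -
    have bc: "b \<in> carrier (group_ring G)" using b by (rule augmentation_ideal_carrier)
    have "a \<in> carrier (group_ring G) \<and> h (a \<star> b) = \<one>\<^bsub>A\<^esub>" using a
    proof (induction a rule: augmentation_ideal_induct)
      case (gen x)
      have "b \<in> carrier (group_ring G) \<and> h ((frag_of x - frag_of \<one>\<^bsub>G\<^esub>) \<star> b) = \<one>\<^bsub>A\<^esub>" using b
      proof (induction b rule: augmentation_ideal_induct)
        case (gen y)
        have "(frag_of x - frag_of \<one>\<^bsub>G\<^esub>) \<star> (frag_of y - frag_of \<one>\<^bsub>G\<^esub>) =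
            (frag_of (x \<otimes>\<^bsub>G\<^esub> y) - frag_of x) - (frag_of y - frag_of \<one>\<^bsub>G\<^esub>)"
          using gen \<open>x \<in> carrier G\<close> by (simp add: group_ring_mult_diff)
        moreover have "f x \<otimes>\<^bsub>A\<^esub> f y \<otimes>\<^bsub>A\<^esub> inv\<^bsub>A\<^esub> f x = f y"
          using gen \<open>x \<in> carrier G\<close> A.m_comm[of "f x" "f y"] by (simp add: A.m_assoc)
        then have "h ((frag_of (x \<otimes>\<^bsub>G\<^esub> y) - frag_of x) - (frag_of y - frag_of \<one>\<^bsub>G\<^esub>)) = \<one>\<^bsub>A\<^esub>"
          using gen \<open>x \<in> carrier G\<close> by (simp add: h_diff hf)
        ultimately show ?case using gen by simp
      qed (use \<open>x \<in> carrier G\<close> in \<open>auto simp: h_zero h_diff group_ring_mult_diff(2)\<close>)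
      then show ?case using gen by simp
    qed (use bc in \<open>auto simp: h_zero h_diff group_ring_mult_diff(1)\<close>)
    then show ?thesis ..
  qed
  have "frag_of g - frag_of \<one>\<^bsub>G\<^esub> \<in> augmentation_ideal_power G (Suc 1)"
    using mem by (simp add: numeral_2_eq_2)
  then have "frag_of g - frag_of \<one>\<^bsub>G\<^esub> \<in> carrier (group_ring G) \<and> h (frag_of g - frag_of \<one>\<^bsub>G\<^esub>) = \<one>\<^bsub>A\<^esub>"
  proof (induction rule: augmentation_ideal_power_induct)
    case (mult b c)
    then have "b \<in> augmentation_ideal G" by (simp only: augmentation_ideal_power_1[OF monoid_axioms])
    then show ?case using prod mult(2) by (auto intro: augmentation_ideal_carrier)
  next
    case (add b c)
    then show ?case by (auto simp: h_add)
  qed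
  then show ?thesis using g by (simp add: h_diff hf)
qed

end

text \<open>
  The quaternion representation maps \<open>\<Delta>\<close> to quaternions with even coordinate sum. A product of two of
  these has coordinates of equal parity, and a product of three is twice a quaternion with even
  coordinate sum. So five factors already give multiples of four.
\<close>

definition even_quats :: "int_quat set" where
  "even_quats = {(p, q, r, s). even (p + q + r + s)}"

definition same_parity_quats :: "int_quat set" where
  "same_parity_quats = {(p, q, r, s). (even p \<longleftrightarrow> even q) \<and> (even q \<longleftrightarrow> even r) \<and> (even r \<longleftrightarrow> even s)}"

definition quat_double :: "int_quat \<Rightarrow> int_quat" where
  "quat_double x = x + x"

lemma quat_mult_add:
  "quat_mult (x + y) w = quat_mult x w + quat_mult y w"
  by (cases x; cases y; cases w; simp add: algebra_simps)

lemma quat_double_mult: "quat_mult (quat_double x) y = quat_double (quat_mult x y)"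
  by (simp add: quat_double_def quat_mult_add)

lemma zero_even_quats: "0 \<in> even_quats"
proof -
  have 0: "(0 :: int_quat) = (0, 0, 0, 0)" by (simp add: zero_prod_def)
  show ?thesis unfolding 0 even_quats_def by simp
qed

lemma even_quats_add: "x \<in> even_quats \<Longrightarrow> y \<in> even_quats \<Longrightarrow> x + y \<in> even_quats"
  by (cases x; cases y) (auto simp: even_quats_def)

lemma even_quats_mult:
  assumes "x \<in> even_quats" "y \<in> even_quats"
  shows "quat_mult x y \<in> same_parity_quats"
proof -
  obtain a b c d where x: "x = (a, b, c, d)" by (cases x)
  obtain a' b' c' d' where y: "y = (a', b', c', d')" by (cases y)
  have "even d \<longleftrightarrow> even (a + b + c)" "even d' \<longleftrightarrow> even (a' + b' + c')"
    using assms by (simp_all add: x y even_quats_def)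
  then show ?thesis
    unfolding x y same_parity_quats_def
    by (cases "even a"; cases "even b"; cases "even c"; cases "even a'"; cases "even b'"; cases "even c'")
       simp_all
qed

text \<open>
  Modulo two, the coordinate sum is a ring homomorphism.
\<close>

lemma even_quats_mult_left:
  assumes "y \<in> even_quats"
  shows "quat_mult x y \<in> even_quats"
proof -
  obtain a b c d where x: "x = (a, b, c, d)" by (cases x)
  obtain a' b' c' d' where y: "y = (a', b', c', d')" by (cases y)
  have "(a * a' - b * b' - c * c' - d * d') + (a * b' + b * a' + c * d' - d * c') +
      (a * c' - b * d' + c * a' + d * b') + (a * d' + b * c' - c * b' + d * a') =
    (a + b + c + d) * (a' + b' + c' + d') -
      2 * (b * b' + c * c' + d * d' + d * c' + b * d' + c * b')"
    by (simp add: algebra_simps)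
  moreover have "even (a' + b' + c' + d')" using assms by (simp add: y even_quats_def)
  then have "even ((a + b + c + d) * (a' + b' + c' + d') -
      2 * (b * b' + c * c' + d * d' + d * c' + b * d' + c * b'))"
    by (intro dvd_diff dvd_mult dvd_triv_left)
  ultimately show ?thesis
    unfolding x y even_quats_def quat_mult.simps mem_Collect_eq prod.case by (simp only:)
qed

text \<open>
  Modulo even quaternions \<open>x\<close> is \<open>0\<close> or \<open>1 + i + j + k\<close>, so that only the product of \<open>1 + i + j + k\<close>
  with \<open>y\<close> has to be computed.
\<close>

lemma same_parity_even_quats_mult:
  assumes x: "x \<in> same_parity_quats" and y: "y \<in> even_quats"
  shows "quat_mult x y \<in> quat_double ` even_quats"
proof -
  obtain a b c d where xe: "x = (a, b, c, d)" by (cases x)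
  define e where "e = a mod 2"
  define w where "w = (a div 2, b div 2, c div 2, d div 2)"
  have "x = quat_double w + (e, e, e, e)"
  proof -
    have "n = n div 2 + n div 2 + e" if "even n \<longleftrightarrow> even a" for n
      using that unfolding e_def by presburger
    from this[of a] this[of b] this[of c] this[of d]
    show ?thesis using x by (simp add: xe w_def quat_double_def same_parity_quats_def)
  qed
  moreover have "quat_mult (e, e, e, e) y \<in> quat_double ` even_quats"
  proof -
    obtain p q r s where ye: "y = (p, q, r, s)" by (cases y)
    have "even (p + q + r + s)"
      using y by (simp only: ye even_quats_def mem_Collect_eq prod.case)
    then obtain t where t: "p + q + r + s = 2 * t" by blast
    then have s: "s = 2 * t - p - q - r" by simp
    have "quat_mult (e, e, e, e) y =
        quat_double (e * (p - t), e * (t - r), e * (p + q + r - t), e * (t - q))"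
      unfolding ye s by (simp add: quat_double_def algebra_simps)
    moreover have "(e * (p - t), e * (t - r), e * (p + q + r - t), e * (t - q)) \<in> even_quats"
    proof -
      have "e * (p - t) + e * (t - r) + e * (p + q + r - t) + e * (t - q) = 2 * (e * p)"
        by (simp add: algebra_simps)
      then show ?thesis unfolding even_quats_def mem_Collect_eq prod.case by (simp only: dvd_triv_left)
    qed
    ultimately show ?thesis by blast
  qed
  then obtain v where v: "v \<in> even_quats" "quat_mult (e, e, e, e) y = quat_double v" by blast
  ultimately have "quat_mult x y = quat_double (quat_mult w y) + quat_double v"
    by (simp only: quat_mult_add quat_double_mult)
  also have "\<dots> = quat_double (quat_mult w y + v)" by (simp add: quat_double_def add_ac)
  finally show ?thesis using even_quats_add[OF even_quats_mult_left[OF y, of w] v(1)] by blast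
qed

context group
begin

lemma quat_eval_augmentation_ideal_power:
  assumes hom: "\<pi> \<in> hom G K8" and a: "a \<in> augmentation_ideal_power G 5"
  shows "quat_eval (group_ring_map \<pi> a) \<in> quat_double ` quat_double ` even_quats"
proof -
  define \<rho> where "\<rho> = (\<lambda>a. quat_eval (group_ring_map \<pi> a))"
  have \<rho>_diff: "\<rho> (a - b) = \<rho> a - \<rho> b" for a b
    by (simp add: \<rho>_def group_ring_map_diff quat_eval_diff)
  have \<rho>_0: "\<rho> 0 = 0" using \<rho>_diff[of 0 0] by simp
  have \<rho>_add: "\<rho> (a + b) = \<rho> a + \<rho> b" for a b using \<rho>_diff[of "a + b" b] by (simp add: algebra_simps)
  have im: "\<pi> ` carrier G \<subseteq> carrier K8" using hom by (auto simp: hom_def)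
  have \<rho>_mult: "\<rho> (a \<star> b) = quat_mult (\<rho> a) (\<rho> b)"
    if "Poly_Mapping.keys a \<subseteq> carrier G" "Poly_Mapping.keys b \<subseteq> carrier G" for a b
  proof -
    have "group_ring_map \<pi> (a \<star> b) = group_ring_map \<pi> a \<otimes>\<^bsub>group_ring K8\<^esub> group_ring_map \<pi> b"
      using hom that by (intro group_ring_map_mult[where H = "carrier G"]) (auto simp: hom_def)
    then show ?thesis
      using quat_eval_mult keys_group_ring_map[OF that(1), of \<pi>] keys_group_ring_map[OF that(2), of \<pi>] im
      by (simp add: \<rho>_def)
  qed
  have \<rho>_of: "\<rho> (frag_of x) = \<pi> x" if "x \<in> carrier G" for x
    using that im by (auto simp: \<rho>_def intro: quat_eval_frag_of)
  have diff: "x - y \<in> even_quats" if "x \<in> even_quats" "y \<in> even_quats" for x y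
    using that by (cases x; cases y) (auto simp: even_quats_def)
  have base: "\<rho> a \<in> even_quats" if "a \<in> augmentation_ideal G" for a
    using that
  proof (induction a rule: augmentation_ideal_induct)
    case zero
    show ?case by (simp add: \<rho>_0 zero_even_quats)
  next
    case (gen g)
    have K8_odd: "k - (1, 0, 0, 0) \<in> even_quats" if "k \<in> carrier K8" for k
    proof -
      obtain p q r s where k: "k = (p, q, r, s)" by (cases k)
      have "odd (p + q + r + s)" using that by (auto simp: k K8_def)
      then show ?thesis by (simp add: k even_quats_def) argo
    qed
    have "\<pi> \<one> = (1, 0, 0, 0)"
      using hom_one[OF hom group_axioms group_K8] by (simp add: K8_def)
    moreover have "\<pi> g - (1, 0, 0, 0) \<in> even_quats"
      by (rule K8_odd) (use gen im in blast)
    ultimately show ?case using gen by (simp add: \<rho>_diff \<rho>_of)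
  qed (simp add: \<rho>_diff diff)
  have step: "\<forall>a\<in>augmentation_ideal_power G (Suc n). \<rho> a \<in> W"
    if V: "\<forall>a\<in>augmentation_ideal_power G n. \<rho> a \<in> V"
      and VW: "\<And>x y. x \<in> V \<Longrightarrow> y \<in> even_quats \<Longrightarrow> quat_mult x y \<in> W"
      and W: "\<And>x y. x \<in> W \<Longrightarrow> y \<in> W \<Longrightarrow> x + y \<in> W" for n V W
  proof
    fix a assume "a \<in> augmentation_ideal_power G (Suc n)"
    then show "\<rho> a \<in> W"
    proof (induction a rule: augmentation_ideal_power_induct)
      case (mult b c)
      then show ?case
        using V VW base augmentation_ideal_power_keys[OF monoid_axioms mult(1)]
        by (simp add: \<rho>_mult augmentation_ideal_iff)
    qed (simp add: \<rho>_add W)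
  qed
  have addS: "x + y \<in> same_parity_quats" if "x \<in> same_parity_quats" "y \<in> same_parity_quats" for x y
    using that by (cases x; cases y) (simp add: same_parity_quats_def)
  have double_add: "x + y \<in> quat_double ` V"
    if "\<And>x y. x \<in> V \<Longrightarrow> y \<in> V \<Longrightarrow> x + y \<in> V" "x \<in> quat_double ` V" "y \<in> quat_double ` V"
    for x y V
  proof -
    from that(2,3) obtain u v where uv: "u \<in> V" "v \<in> V" "x = quat_double u" "y = quat_double v" by blast
    then have "x + y = quat_double (u + v)" by (simp add: quat_double_def add_ac)
    then show ?thesis using that(1) uv by blast
  qed
  have double_mult: "quat_mult x y \<in> quat_double ` W"
    if "\<And>x y. x \<in> V \<Longrightarrow> y \<in> even_quats \<Longrightarrow> quat_mult x y \<in> W"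
      "x \<in> quat_double ` V" "y \<in> even_quats" for x y V W
  proof -
    from that(2) obtain u where "u \<in> V" "x = quat_double u" by blast
    then show ?thesis using that(1)[OF _ that(3)] by (simp add: quat_double_mult)
  qed
  \<comment> \<open>Each factor from \<open>\<Delta>\<close> moves the image one step along even, equal parity, twice even, and so on.\<close>
  have 1: "\<forall>a\<in>augmentation_ideal_power G 1. \<rho> a \<in> even_quats"
    unfolding augmentation_ideal_power_1[OF monoid_axioms] using base by blast
  have 2: "\<forall>a\<in>augmentation_ideal_power G (Suc 1). \<rho> a \<in> same_parity_quats"
    by (rule step[OF 1 even_quats_mult addS])
  have 3: "\<forall>a\<in>augmentation_ideal_power G (Suc (Suc 1)). \<rho> a \<in> quat_double ` even_quats"
    by (rule step[OF 2 same_parity_even_quats_mult double_add[OF even_quats_add]])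
  have 4: "\<forall>a\<in>augmentation_ideal_power G (Suc (Suc (Suc 1))). \<rho> a \<in> quat_double ` same_parity_quats"
    by (rule step[OF 3 double_mult[OF even_quats_mult] double_add[OF addS]])
  have 5: "\<forall>a\<in>augmentation_ideal_power G (Suc (Suc (Suc (Suc 1)))).
      \<rho> a \<in> quat_double ` quat_double ` even_quats"
    by (rule step[OF 4 double_mult[OF same_parity_even_quats_mult] double_add[OF double_add[OF even_quats_add]]])
  have "a \<in> augmentation_ideal_power G (Suc (Suc (Suc (Suc 1))))"
    using a by (simp add: eval_nat_numeral)
  then show ?thesis using 5 unfolding \<rho>_def by blast
qed

text \<open>
  The component of \<open>g\<close> in \<open>E\<close> is trivial because \<open>E\<close> is commutative. For the component \<open>k\<close> in
  \<^const>\<open>K8\<close>, the coordinates of \<open>k - 1\<close> are multiples of four, but at most two in absolute value.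
\<close>

lemma trivial_of_augmentation_ideal_power_5:
  assumes E: "elementary_abelian_2_group E" and f: "f \<in> iso G (K8 \<times>\<times> E)"
    and g: "g \<in> carrier G" and mem: "frag_of g - frag_of \<one> \<in> augmentation_ideal_power G 5"
  shows "g = \<one>"
proof -
  interpret E: comm_group E using E by (simp add: elementary_abelian_2_group_def)
  have fhom: "f \<in> hom G (K8 \<times>\<times> E)" and inj: "inj_on f (carrier G)"
    using f by (auto simp: iso_def bij_betw_def)
  define \<pi> where "\<pi> = fst \<circ> f"
  define \<eta> where "\<eta> = snd \<circ> f"
  have \<pi>: "\<pi> \<in> hom G K8" and \<eta>: "\<eta> \<in> hom G E"
    using fhom by (auto simp: hom_def \<pi>_def \<eta>_def mult_DirProd' Pi_iff mem_Times_iff)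
  have one: "\<pi> \<one> = \<one>\<^bsub>K8\<^esub>" "\<eta> \<one> = \<one>\<^bsub>E\<^esub>"
    using hom_one[OF \<pi> group_axioms group_K8] hom_one[OF \<eta> group_axioms E.group_axioms] by auto
  have "frag_of g - frag_of \<one> \<in> augmentation_ideal_power G 2"
    using mem augmentation_ideal_power_antimono[OF monoid_axioms, of 2 5] by auto
  then have \<eta>g: "\<eta> g = \<one>\<^bsub>E\<^esub>"
    by (rule hom_trivial_of_augmentation_ideal_square[OF E.comm_group_axioms \<eta> g])
  have "\<pi> g - (1, 0, 0, 0) \<in> quat_double ` quat_double ` even_quats"
  proof -
    have "\<pi> g \<in> carrier K8" "\<pi> \<one> = (1, 0, 0, 0)" "(1, 0, 0, 0) \<in> carrier K8"
      using \<pi> g one by (auto simp: hom_def) (simp_all add: K8_def)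
    then have "quat_eval (group_ring_map \<pi> (frag_of g - frag_of \<one>)) = \<pi> g - (1, 0, 0, 0)"
      by (simp add: group_ring_map_diff quat_eval_diff quat_eval_frag_of)
    then show ?thesis using quat_eval_augmentation_ideal_power[OF \<pi> mem] by simp
  qed
  moreover have "\<forall>k\<in>carrier K8. k - (1, 0, 0, 0) \<in> quat_double ` quat_double ` even_quats \<longrightarrow> k = \<one>\<^bsub>K8\<^esub>"
  proof -
    have dvd4: "4 dvd fst x \<and> 4 dvd fst (snd x) \<and> 4 dvd fst (snd (snd x)) \<and> 4 dvd snd (snd (snd x))"
      if "x \<in> quat_double ` quat_double ` even_quats" for x
      using that by (auto simp: quat_double_def)
    then have *: "k - (1, 0, 0, 0) \<in> quat_double ` quat_double ` even_quats \<Longrightarrow>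
        4 dvd fst k - 1 \<and> 4 dvd fst (snd k) \<and> 4 dvd fst (snd (snd k)) \<and> 4 dvd snd (snd (snd k))" for k
      using dvd4[of "k - (1, 0, 0, 0)"] by (cases k) simp
    have "\<forall>k\<in>carrier K8. 4 dvd fst k - 1 \<and> 4 dvd fst (snd k) \<and> 4 dvd fst (snd (snd k)) \<and>
        4 dvd snd (snd (snd k)) \<longrightarrow> k = \<one>\<^bsub>K8\<^esub>"
      by (simp add: K8_def)
    then show ?thesis using * by blast
  qed
  moreover have "\<pi> g \<in> carrier K8" using \<pi> g by (auto simp: hom_def)
  ultimately have "\<pi> g = \<one>\<^bsub>K8\<^esub>" by blast
  then have "f g = f \<one>" using \<eta>g one by (simp add: \<pi>_def \<eta>_def prod_eq_iff)
  then show ?thesis using inj g by (auto simp: inj_on_def)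
qed

end

section \<open>Groups whose congruence units become trivial\<close>

text \<open>
  For every other \<open>n\<close> there is an \<open>i\<close> coprime to \<open>n\<close> with \<open>1 < i \<le> n / 2\<close>: take \<open>2\<close> for odd \<open>n\<close>,
  \<open>n / 2 - 2\<close> if \<open>n\<close> is twice an odd number, and \<open>n / 2 - 1\<close> if four divides \<open>n\<close>.
\<close>

lemma order_in_1_2_3_4_6:
  fixes n :: nat
  assumes n: "n \<ge> 1" and *: "\<And>i. coprime i n \<Longrightarrow> i > 1 \<Longrightarrow> 2 * i > n"
  shows "n \<in> {1, 2, 3, 4, 6}"
proof (rule ccontr)
  assume "n \<notin> {1, 2, 3, 4, 6}"
  then have n5: "n \<ge> 5" "n \<noteq> 6" using n by auto
  consider "odd n" | r where "n = 2 * r" "odd r" | q where "n = 4 * q"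
  proof -
    have "n = 2 * (n div 2) \<and> odd (n div 2) \<or> n = 4 * (n div 4) \<or> odd n" by presburger
    then show ?thesis using that by blast
  qed
  then show False
  proof cases
    case 1
    then show False using *[of 2] n5 by simp
  next
    case (2 r)
    have r: "r \<ge> 5" using 2 n5 by (cases "r = 4") auto
    have odd: "odd (r - 2)" using 2 r by simp
    then have "gcd (r - 2) 2 = 1" by (simp flip: coprime_iff_gcd_eq_1)
    then have "gcd (r - 2) (r - 2 + 2) = 1" by (simp only: gcd_add2)
    moreover have "r - 2 + 2 = r" using r by simp
    ultimately have "coprime (r - 2) r" by (simp only: coprime_iff_gcd_eq_1)
    with odd have "coprime (r - 2) n" by (simp add: 2)
    from *[OF this] show False using 2 r by linarith
  next
    case (3 q)
    have q: "q \<ge> 2" using 3 n5 by simp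
    have "coprime (2 * q - 1) (2 * q)" using q by (intro coprime_diff_one_left_nat) simp
    moreover have "coprime (2 * q - 1) 2" using q by simp
    moreover have "n = 2 * (2 * q)" by (simp add: 3)
    ultimately have "coprime (2 * q - 1) n" by (simp only: coprime_mult_right_iff)
    from *[OF this] show False using 3 q by linarith
  qed
qed

context group
begin

lemma congruence_units_singleton:
  assumes "\<And>g. g \<in> carrier G \<Longrightarrow> frag_of g - frag_of \<one> \<in> augmentation_ideal_power G n \<Longrightarrow> g = \<one>"
    and "\<And>u. u \<in> Units (group_ring G) \<Longrightarrow> \<exists>g\<in>carrier G. u = frag_of g \<or> u = - frag_of g"
  shows "congruence_units G n = {\<one>\<^bsub>group_ring G\<^esub>}"
proof -
  interpret ZG: ring "group_ring G" by (rule ring_group_ring) (rule monoid_axioms)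
  have "u = frag_of \<one>" if u: "u \<in> congruence_units G n" for u
  proof -
    have un: "u \<in> Units (group_ring G)" "augmentation u = 1"
      and mem: "u - frag_of \<one> \<in> augmentation_ideal_power G n"
      using u by (auto simp: congruence_units_iff[OF monoid_axioms] normalized_units_def)
    obtain g where g: "g \<in> carrier G" "u = frag_of g \<or> u = - frag_of g"
      using assms(2)[OF un(1)] by blast
    then have "u = frag_of g" using un(2) by (auto simp: augmentation_uminus)
    then show ?thesis using assms(1)[OF g(1)] mem by simp
  qed
  moreover have "frag_of \<one> \<in> congruence_units G n"
  proof -
    have "frag_of \<one> \<in> Units (group_ring G)" using ZG.Units_one_closed by (simp add: group_ring_one_eq)
    moreover have "0 \<in> augmentation_ideal_power G n"
      using additive_subgroup.zero_closed[OF ideal.axioms(1)[OF ideal_augmentation_ideal_power[OF monoid_axioms]]]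
      by (simp add: group_ring_simps(4))
    ultimately show ?thesis
      by (simp add: congruence_units_iff[OF monoid_axioms] normalized_units_def)
  qed
  ultimately show ?thesis unfolding group_ring_one_eq by blast
qed

end

theorem theorem2:
  fixes G :: "('a, 'b) monoid_scheme"
  assumes "group G" and "finite (carrier G)"
  shows "(\<exists>n::nat. n \<ge> 1 \<and> congruence_units G n = {\<one>\<^bsub>group_ring G\<^esub>}) \<longleftrightarrow>
    (comm_group G \<and> cut_group G) \<or>
    (\<exists>E :: 'a monoid. elementary_abelian_2_group E \<and> G \<cong> K8 \<times>\<times> E)"
proof
  interpret group G by fact
  note fin = assms(2)
  {
    assume "\<exists>n::nat. n \<ge> 1 \<and> congruence_units G n = {\<one>\<^bsub>group_ring G\<^esub>}"
    then obtain n :: nat where n: "n \<ge> 1" "congruence_units G n = {\<one>\<^bsub>group_ring G\<^esub>}" by blast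
    obtain m :: nat where m: "m \<ge> 1" "\<forall>u\<in>normalized_units G. u [^]\<^bsub>group_ring G\<^esub> m = frag_of \<one>\<^bsub>G\<^esub>"
      using torsion_of_congruence_units_trivial[OF fin n] by blast
    show "(comm_group G \<and> cut_group G) \<or>
      (\<exists>E :: 'a monoid. elementary_abelian_2_group E \<and> G \<cong> K8 \<times>\<times> E)"
    proof (cases "comm_group G")
      case True
      then show ?thesis using comm_group.cut_group_of_units_torsion[OF True fin m] by blast
    next
      case False
      interpret hamiltonian_small_orders G
      proof
        show "\<exists>k::nat. x \<otimes>\<^bsub>G\<^esub> y = y \<otimes>\<^bsub>G\<^esub> x [^]\<^bsub>G\<^esub> k" if "x \<in> carrier G" "y \<in> carrier G" for x y
          using conjugate_power_of_units_torsion[OF fin that m] .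
        show "ord x \<in> {1, 2, 3, 4, 6}" if "x \<in> carrier G" for x
          using order_in_1_2_3_4_6[OF ord_ge_1[OF fin that] coprime_bound_of_units_torsion[OF fin that m]] .
        show "\<exists>x\<in>carrier G. \<exists>y\<in>carrier G. x \<otimes>\<^bsub>G\<^esub> y \<noteq> y \<otimes>\<^bsub>G\<^esub> x"
          using False group_comm_groupI by blast
      qed
      obtain a b where "quaternion_pair G a b"
        "\<And>g. g \<in> carrier G \<Longrightarrow> \<exists>q\<in>{\<one>\<^bsub>G\<^esub>, a, b, a \<otimes>\<^bsub>G\<^esub> b}. \<exists>c\<in>carrier G. c \<otimes>\<^bsub>G\<^esub> c = \<one>\<^bsub>G\<^esub> \<and> g = q \<otimes>\<^bsub>G\<^esub> c"
        using quaternion_decomposition by blast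
      then show ?thesis
        using iso_K8_times_elementary_abelian[OF fin] square_one_central by blast
    qed
  }
  {
    assume "(comm_group G \<and> cut_group G) \<or>
      (\<exists>E :: 'a monoid. elementary_abelian_2_group E \<and> G \<cong> K8 \<times>\<times> E)"
    then show "\<exists>n::nat. n \<ge> 1 \<and> congruence_units G n = {\<one>\<^bsub>group_ring G\<^esub>}"
    proof
      assume G: "comm_group G \<and> cut_group G"
      interpret comm_group G using G by simp
      interpret ZG: cring "group_ring G" by (rule cring_group_ring)
      have "congruence_units G 2 = {\<one>\<^bsub>group_ring G\<^esub>}"
      proof (rule congruence_units_singleton)
        show "g = \<one>\<^bsub>G\<^esub>" if "g \<in> carrier G" "frag_of g - frag_of \<one>\<^bsub>G\<^esub> \<in> augmentation_ideal_power G 2" for g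
          using hom_trivial_of_augmentation_ideal_square[OF comm_group_axioms _ that, of "\<lambda>x. x"]
          by (simp add: hom_def)
        show "\<exists>g\<in>carrier G. u = frag_of g \<or> u = - frag_of g" if "u \<in> Units (group_ring G)" for u
          using G that ZG.m_comm ZG.Units_closed[OF that]
          unfolding cut_group_def central_units_def by blast
      qed
      then show ?thesis by (intro exI[of _ 2]) simp
    next
      assume "\<exists>E :: 'a monoid. elementary_abelian_2_group E \<and> G \<cong> K8 \<times>\<times> E"
      then obtain E :: "'a monoid" and f where E: "elementary_abelian_2_group E"
        and f: "f \<in> iso G (K8 \<times>\<times> E)" by (auto simp: is_iso_def)
      have "congruence_units G 5 = {\<one>\<^bsub>group_ring G\<^esub>}"
      proof (rule congruence_units_singleton)
        show "g = \<one>\<^bsub>G\<^esub>" if "g \<in> carrier G" "frag_of g - frag_of \<one>\<^bsub>G\<^esub> \<in> augmentation_ideal_power G 5" for g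
          using trivial_of_augmentation_ideal_power_5[OF E f that] .
        show "\<exists>g\<in>carrier G. u = frag_of g \<or> u = - frag_of g" if "u \<in> Units (group_ring G)" for u
          using trivial_units_K8_times_elementary_abelian[OF fin E f] that
          unfolding trivial_units_on_def units_group_ring_iff[OF monoid_axioms] by blast
      qed
      then show ?thesis by (intro exI[of _ 5]) simp
    qed
  }
qed

end
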